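(* Let $\mathcal S,\mathcal A$ be finite sets. Suppose that we are given arrays of transition probabilities $\mathcal P=(P_a)_{a\in\mathcal A}$, where $P_a(i,j)=p_{ij}(a)$ for $i,j\in\mathcal S$, and a randomized policy $\pi=\{\pi_{i,a}\}_{i\in\mathcal S,a\in\mathcal A}$. We are also given a stream of updates to the policy, each update taking the form $\pi_{i,a}\leftarrow\tilde\pi_{i,a}$, $\pi_i\leftarrow\pi_i/\|\pi_i\|_1$ for some $i\in\mathcal S$, $a\in\mathcal A$. There exists an algorithm that preprocesses $\mathcal P$ in $\tilde{\mathcal O}(|\mathcal S|^2|\mathcal A|)$ time, makes each update in $\mathcal O(\log|\mathcal A|)$ time, and, for any initial state and at any time, generates a single state transition of the Markov decision process under the current policy in $\mathcal O(\log|\mathcal A|)+\mathcal O(\log|\mathcal S|)$ time.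
   Context: A Markov decision process has finite state space $\mathcal S$, finite action space $\mathcal A$ and transition probabilities $p_{ij}(a)$ ($i,j\in\mathcal S$, $a\in\mathcal A$), with $p_{ij}(a)\ge0$, $\sum_jp_{ij}(a)=1$. A randomized policy $\pi=(\pi_i)_{i\in\mathcal S}$ assigns to each state $i$ a probability distribution $\pi_i=(\pi_{i,a})_{a\in\mathcal A}$ on $\mathcal A$. Generating a state transition from state $i$ under $\pi$ means drawing an action $a$ with probability $\pi_{i,a}$ and then a next state $j$ with probability $p_{ij}(a)$. In an update, $\tilde\pi_{i,a}$ is a given nonnegative number which replaces the entry $\pi_{i,a}$, after which the vector $\pi_i$ is renormalized to have sum one. Time is the number of arithmetic operations (query of an entry of the input, addition, subtraction, multiplication, division, exponentiation; drawing a uniform random number from $[0,1]$ is available). $\tilde{\mathcal O}(\cdot)$ hides factors polylogarithmic in $|\mathcal S|,|\mathcal A|$. *)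

theory Defs
  imports "HOL-Probability.Probability"
begin

section \<open>Markov decision processes, policies, policy updates\<close>

text \<open>
  States and actions are array indices: the state space is \<open>{..<n}\<close>, the action space
  \<open>{..<m}\<close>.  \<open>P a i j\<close> is the probability of moving from \<open>i\<close> to \<open>j\<close> under action \<open>a\<close>, and
  \<open>\<pi> i a\<close> the probability of choosing \<open>a\<close> in \<open>i\<close>.  Values at indices outside these ranges are
  arbitrary.
\<close>

definition is_mdp :: "nat \<Rightarrow> nat \<Rightarrow> (nat \<Rightarrow> nat \<Rightarrow> nat \<Rightarrow> real) \<Rightarrow> bool" where
  "is_mdp n m P \<longleftrightarrow>
     (\<forall>a<m. \<forall>i<n. (\<forall>j<n. P a i j \<ge> 0) \<and> (\<Sum>j<n. P a i j) = 1)"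

definition is_policy :: "nat \<Rightarrow> nat \<Rightarrow> (nat \<Rightarrow> nat \<Rightarrow> real) \<Rightarrow> bool" where
  "is_policy n m \<pi> \<longleftrightarrow> (\<forall>i<n. (\<forall>a<m. \<pi> i a \<ge> 0) \<and> (\<Sum>a<m. \<pi> i a) = 1)"

definition norm1 :: "nat \<Rightarrow> (nat \<Rightarrow> real) \<Rightarrow> real" where
  "norm1 m v = (\<Sum>a<m. \<bar>v a\<bar>)"

definition update_policy ::
  "nat \<Rightarrow> (nat \<Rightarrow> nat \<Rightarrow> real) \<Rightarrow> nat \<Rightarrow> nat \<Rightarrow> real \<Rightarrow> (nat \<Rightarrow> nat \<Rightarrow> real)" where
  "update_policy m \<pi> i a x =
     (let v = (\<pi> i)(a := x) in \<pi>(i := (\<lambda>b. v b / norm1 m v)))"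

text \<open>The last conjunct says that the renormalization is defined.\<close>

definition valid_update ::
  "nat \<Rightarrow> nat \<Rightarrow> (nat \<Rightarrow> nat \<Rightarrow> real) \<Rightarrow> nat \<Rightarrow> nat \<Rightarrow> real \<Rightarrow> bool" where
  "valid_update n m \<pi> i a x \<longleftrightarrow>
     i < n \<and> a < m \<and> x \<ge> 0 \<and> norm1 m ((\<pi> i)(a := x)) > 0"


section \<open>A randomized real random access machine\<close>

text \<open>
  Algorithms are programs of a small imperative language.  The memory consists of an array of
  natural numbers (also used as addresses) and an array of real numbers; there is no operation
  from real to natural numbers, so no rounding is available.  Every node of an expression and
  every command other than sequencing is charged one unit.  The running time is therefore an upper
  bound for the number of arithmetic operations, input queries and random draws, and also accounts
  for memory accesses, comparisons and control flow.  Natural subtraction and division are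
  the truncating ones, and dividing by zero gives zero.
\<close>

datatype iexp =
    IConst nat
  | ILoad iexp
  | IAdd iexp iexp
  | ISub iexp iexp
  | IMul iexp iexp
  | IDiv iexp iexp

datatype rexp =
    ROfNat iexp
  | RLoad iexp
  | QueryP iexp iexp iexp
  | QueryPol iexp iexp
  | RAdd rexp rexp
  | RSub rexp rexp
  | RMul rexp rexp
  | RDiv rexp rexp
  | RPow rexp rexp

datatype bexp =
    ILess iexp iexp
  | IEq iexp iexp
  | RLess rexp rexp

datatype com =
    Skip
  | IStore iexp iexp
  | RStore iexp rexp
  | Draw iexp
  | Seq com com
  | Cond bexp com com
  | While bexp com

text \<open>
  \<open>rnd\<close> is the stream of random numbers not yet consumed; it is accessible to a program only
  through \<open>Draw\<close>.
\<close>

record store =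
  imem :: "nat \<Rightarrow> nat"
  rmem :: "nat \<Rightarrow> real"
  rnd  :: "nat \<Rightarrow> real"

fun ival :: "store \<Rightarrow> iexp \<Rightarrow> nat" where
  "ival s (IConst k) = k"
| "ival s (ILoad e) = imem s (ival s e)"
| "ival s (IAdd e f) = ival s e + ival s f"
| "ival s (ISub e f) = ival s e - ival s f"
| "ival s (IMul e f) = ival s e * ival s f"
| "ival s (IDiv e f) = ival s e div ival s f"

fun icost :: "iexp \<Rightarrow> nat" where
  "icost (IConst k) = 1"
| "icost (ILoad e) = 1 + icost e"
| "icost (IAdd e f) = 1 + icost e + icost f"
| "icost (ISub e f) = 1 + icost e + icost f"
| "icost (IMul e f) = 1 + icost e + icost f"
| "icost (IDiv e f) = 1 + icost e + icost f"

text \<open>The parameters \<open>P\<close> and \<open>\<pi>\<close> are the (read-only) input arrays.\<close>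

fun rval :: "(nat \<Rightarrow> nat \<Rightarrow> nat \<Rightarrow> real) \<Rightarrow> (nat \<Rightarrow> nat \<Rightarrow> real) \<Rightarrow> store \<Rightarrow> rexp \<Rightarrow> real" where
  "rval P \<pi> s (ROfNat e) = real (ival s e)"
| "rval P \<pi> s (RLoad e) = rmem s (ival s e)"
| "rval P \<pi> s (QueryP e f g) = P (ival s e) (ival s f) (ival s g)"
| "rval P \<pi> s (QueryPol e f) = \<pi> (ival s e) (ival s f)"
| "rval P \<pi> s (RAdd e f) = rval P \<pi> s e + rval P \<pi> s f"
| "rval P \<pi> s (RSub e f) = rval P \<pi> s e - rval P \<pi> s f"
| "rval P \<pi> s (RMul e f) = rval P \<pi> s e * rval P \<pi> s f"
| "rval P \<pi> s (RDiv e f) = rval P \<pi> s e / rval P \<pi> s f"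
| "rval P \<pi> s (RPow e f) = rval P \<pi> s e powr rval P \<pi> s f"

fun rcost :: "rexp \<Rightarrow> nat" where
  "rcost (ROfNat e) = 1 + icost e"
| "rcost (RLoad e) = 1 + icost e"
| "rcost (QueryP e f g) = 1 + icost e + icost f + icost g"
| "rcost (QueryPol e f) = 1 + icost e + icost f"
| "rcost (RAdd e f) = 1 + rcost e + rcost f"
| "rcost (RSub e f) = 1 + rcost e + rcost f"
| "rcost (RMul e f) = 1 + rcost e + rcost f"
| "rcost (RDiv e f) = 1 + rcost e + rcost f"
| "rcost (RPow e f) = 1 + rcost e + rcost f"

fun bval :: "(nat \<Rightarrow> nat \<Rightarrow> nat \<Rightarrow> real) \<Rightarrow> (nat \<Rightarrow> nat \<Rightarrow> real) \<Rightarrow> store \<Rightarrow> bexp \<Rightarrow> bool" where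
  "bval P \<pi> s (ILess e f) \<longleftrightarrow> ival s e < ival s f"
| "bval P \<pi> s (IEq e f) \<longleftrightarrow> ival s e = ival s f"
| "bval P \<pi> s (RLess e f) \<longleftrightarrow> rval P \<pi> s e < rval P \<pi> s f"

fun bcost :: "bexp \<Rightarrow> nat" where
  "bcost (ILess e f) = 1 + icost e + icost f"
| "bcost (IEq e f) = 1 + icost e + icost f"
| "bcost (RLess e f) = 1 + rcost e + rcost f"

text \<open>
  \<open>exec P \<pi> c s t s'\<close>: on input arrays \<open>P\<close>, \<open>\<pi>\<close>, the program \<open>c\<close> started in \<open>s\<close> halts after
  exactly \<open>t\<close> time units in \<open>s'\<close>.
\<close>

inductive exec ::
  "(nat \<Rightarrow> nat \<Rightarrow> nat \<Rightarrow> real) \<Rightarrow> (nat \<Rightarrow> nat \<Rightarrow> real) \<Rightarrow> com \<Rightarrow> store \<Rightarrow> nat \<Rightarrow> store \<Rightarrow> bool"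
  for P :: "nat \<Rightarrow> nat \<Rightarrow> nat \<Rightarrow> real" and \<pi> :: "nat \<Rightarrow> nat \<Rightarrow> real" where
  Skip: "exec P \<pi> Skip s 1 s"
| IStore: "exec P \<pi> (IStore e f) s (1 + icost e + icost f)
             (s\<lparr>imem := (imem s)(ival s e := ival s f)\<rparr>)"
| RStore: "exec P \<pi> (RStore e f) s (1 + icost e + rcost f)
             (s\<lparr>rmem := (rmem s)(ival s e := rval P \<pi> s f)\<rparr>)"
| Draw: "exec P \<pi> (Draw e) s (1 + icost e)
           (s\<lparr>rmem := (rmem s)(ival s e := rnd s 0), rnd := (\<lambda>k. rnd s (Suc k))\<rparr>)"
| Seq: "exec P \<pi> c s t s' \<Longrightarrow> exec P \<pi> d s' t' s'' \<Longrightarrow> exec P \<pi> (Seq c d) s (t + t') s''"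
| CondTrue: "bval P \<pi> s b \<Longrightarrow> exec P \<pi> c s t s' \<Longrightarrow>
               exec P \<pi> (Cond b c d) s (1 + bcost b + t) s'"
| CondFalse: "\<not> bval P \<pi> s b \<Longrightarrow> exec P \<pi> d s t s' \<Longrightarrow>
               exec P \<pi> (Cond b c d) s (1 + bcost b + t) s'"
| WhileFalse: "\<not> bval P \<pi> s b \<Longrightarrow> exec P \<pi> (While b c) s (1 + bcost b) s"
| WhileTrue: "bval P \<pi> s b \<Longrightarrow> exec P \<pi> c s t s' \<Longrightarrow> exec P \<pi> (While b c) s' t' s'' \<Longrightarrow>
               exec P \<pi> (While b c) s (1 + bcost b + t + t') s''"

inductive_cases exec_SkipE: "exec P \<pi> Skip s t s'"
  and exec_IStoreE: "exec P \<pi> (IStore e f) s t s'"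
  and exec_RStoreE: "exec P \<pi> (RStore e f) s t s'"
  and exec_DrawE: "exec P \<pi> (Draw e) s t s'"
  and exec_SeqE: "exec P \<pi> (Seq c d) s t s'"
  and exec_CondE: "exec P \<pi> (Cond b c d) s t s'"
  and exec_WhileE: "exec P \<pi> (While b c) s t s'"

lemma exec_deterministic:
  "exec P \<pi> c s t s' \<Longrightarrow> exec P \<pi> c s t2 s2 \<Longrightarrow> t2 = t \<and> s2 = s'"
proof (induction arbitrary: t2 s2 rule: exec.induct)
  case (Skip s)
  then show ?case by (rule exec_SkipE) simp
next
  case (IStore e f s)
  then show ?case by (rule exec_IStoreE) simp
next
  case (RStore e f s)
  then show ?case by (rule exec_RStoreE) simp
next
  case (Draw e s)
  then show ?case by (rule exec_DrawE) simp
next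
  case (Seq c s t s' d t' s'')
  from Seq.prems show ?case
  proof (rule exec_SeqE)
    fix t1 s1 t1'
    assume eq: "t2 = t1 + t1'" and c: "exec P \<pi> c s t1 s1" and d: "exec P \<pi> d s1 t1' s2"
    from Seq.IH(1)[OF c] d have "exec P \<pi> d s' t1' s2" by simp
    from Seq.IH(2)[OF this] Seq.IH(1)[OF c] eq show ?thesis by simp
  qed
next
  case (CondTrue s b c t s' d)
  from CondTrue.prems show ?case
    by (rule exec_CondE) (use CondTrue.hyps in \<open>auto dest: CondTrue.IH\<close>)
next
  case (CondFalse s b d t s' c)
  from CondFalse.prems show ?case
    by (rule exec_CondE) (use CondFalse.hyps in \<open>auto dest: CondFalse.IH\<close>)
next
  case (WhileFalse s b c)
  from WhileFalse.prems show ?case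
    by (rule exec_WhileE) (use WhileFalse.hyps in simp_all)
next
  case (WhileTrue s b c t s' t' s'')
  from WhileTrue.prems show ?case
  proof (rule exec_WhileE)
    assume "\<not> bval P \<pi> s b"
    with WhileTrue.hyps show ?thesis by simp
  next
    fix t1 s1 t1'
    assume eq: "t2 = Suc (bcost b + t1 + t1')" and c: "exec P \<pi> c s t1 s1"
      and d: "exec P \<pi> (While b c) s1 t1' s2"
    from WhileTrue.IH(1)[OF c] d have "exec P \<pi> (While b c) s' t1' s2" by simp
    from WhileTrue.IH(2)[OF this] WhileTrue.IH(1)[OF c] eq show ?thesis by simp
  qed
qed

definition halts_within ::
  "(nat \<Rightarrow> nat \<Rightarrow> nat \<Rightarrow> real) \<Rightarrow> (nat \<Rightarrow> nat \<Rightarrow> real) \<Rightarrow> com \<Rightarrow> store \<Rightarrow> real \<Rightarrow> bool" where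
  "halts_within P \<pi> c s b \<longleftrightarrow> (\<exists>t s'. exec P \<pi> c s t s' \<and> real t \<le> b)"

text \<open>
  The random numbers are independent and uniform on \<open>[0,1]\<close>; the space of this measure consists of
  the sequences with all entries in \<open>[0,1]\<close>.
\<close>

definition uniforms :: "(nat \<Rightarrow> real) measure" where
  "uniforms = PiM UNIV (\<lambda>_. restrict_space lborel {0..1})"


section \<open>Preprocessing, updating and sampling\<close>

text \<open>
  Calling conventions: the arguments of a call are written to natural cells 0, 1 and real cell 0,
  and the call receives a fresh sequence \<open>u\<close> of random numbers; the rest of the memory
  is kept between calls and is initially zero.  Preprocessing receives \<open>n\<close>, \<open>m\<close>; the update
  \<open>\<pi> i a \<leftarrow> x\<close> receives \<open>i\<close>, \<open>a\<close>, \<open>x\<close>; sampling receives the state \<open>i\<close> and returns the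
  action and the next state in natural cells 0 and 1.
\<close>

definition call :: "store \<Rightarrow> nat \<Rightarrow> nat \<Rightarrow> real \<Rightarrow> (nat \<Rightarrow> real) \<Rightarrow> store" where
  "call s i a x u =
     s\<lparr>imem := (imem s)(0 := i, 1 := a), rmem := (rmem s)(0 := x), rnd := u\<rparr>"

definition prep_call :: "nat \<Rightarrow> nat \<Rightarrow> (nat \<Rightarrow> real) \<Rightarrow> store" where
  "prep_call n m u =
     call \<lparr>imem = (\<lambda>_. 0), rmem = (\<lambda>_. 0), rnd = u\<rparr> n m 0 u"

definition update_call :: "store \<Rightarrow> nat \<Rightarrow> nat \<Rightarrow> real \<Rightarrow> (nat \<Rightarrow> real) \<Rightarrow> store" where
  "update_call s i a x u = call s i a x u"

definition sample_call :: "store \<Rightarrow> nat \<Rightarrow> (nat \<Rightarrow> real) \<Rightarrow> store" where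
  "sample_call s i u = call s i 0 0 u"

text \<open>
  \<open>reachable prep upd smp n m P \<pi>\<^sub>0 \<pi> s\<close>: after preprocessing \<open>P\<close> and the initial policy
  \<open>\<pi>\<^sub>0\<close>, some finite interleaving of updates and sampling calls makes \<open>\<pi>\<close> the current policy and
  leaves the memory \<open>s\<close>.  All outcomes of the random draws are admitted, so updates and
  sampling calls may be chosen adaptively, depending on the transitions generated before.
\<close>

inductive reachable ::
  "com \<Rightarrow> com \<Rightarrow> com \<Rightarrow> nat \<Rightarrow> nat \<Rightarrow> (nat \<Rightarrow> nat \<Rightarrow> nat \<Rightarrow> real) \<Rightarrow> (nat \<Rightarrow> nat \<Rightarrow> real) \<Rightarrow>
   (nat \<Rightarrow> nat \<Rightarrow> real) \<Rightarrow> store \<Rightarrow> bool"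
  for prep upd smp :: com and n m :: nat
    and P :: "nat \<Rightarrow> nat \<Rightarrow> nat \<Rightarrow> real" and \<pi>\<^sub>0 :: "nat \<Rightarrow> nat \<Rightarrow> real" where
  prep: "\<lbrakk>u \<in> space uniforms; exec P \<pi>\<^sub>0 prep (prep_call n m u) t s\<rbrakk>
    \<Longrightarrow> reachable prep upd smp n m P \<pi>\<^sub>0 \<pi>\<^sub>0 s"
| update: "\<lbrakk>reachable prep upd smp n m P \<pi>\<^sub>0 \<pi> s; valid_update n m \<pi> i a x;
     u \<in> space uniforms; exec P \<pi>\<^sub>0 upd (update_call s i a x u) t s'\<rbrakk>
    \<Longrightarrow> reachable prep upd smp n m P \<pi>\<^sub>0 (update_policy m \<pi> i a x) s'"
| sample: "\<lbrakk>reachable prep upd smp n m P \<pi>\<^sub>0 \<pi> s; i < n;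
     u \<in> space uniforms; exec P \<pi>\<^sub>0 smp (sample_call s i u) t s'\<rbrakk>
    \<Longrightarrow> reachable prep upd smp n m P \<pi>\<^sub>0 \<pi> s'"

definition sample_event ::
  "com \<Rightarrow> (nat \<Rightarrow> nat \<Rightarrow> nat \<Rightarrow> real) \<Rightarrow> (nat \<Rightarrow> nat \<Rightarrow> real) \<Rightarrow> store \<Rightarrow> nat \<Rightarrow> nat \<Rightarrow> nat \<Rightarrow>
   (nat \<Rightarrow> real) set" where
  "sample_event smp P \<pi>\<^sub>0 s i a j =
     {u \<in> space uniforms. \<exists>t s'. exec P \<pi>\<^sub>0 smp (sample_call s i u) t s' \<and>
        imem s' 0 = a \<and> imem s' 1 = j}"

text \<open>
  In memory \<open>s\<close>, the program \<open>smp\<close> generates a transition from \<open>i\<close> under the current policy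
  \<open>\<pi>\<close>: an action \<open>a\<close> is drawn with probability \<open>\<pi> i a\<close> and then a next state \<open>j\<close> with
  probability \<open>P a i j\<close>.
\<close>

definition generates_transition ::
  "com \<Rightarrow> nat \<Rightarrow> nat \<Rightarrow> (nat \<Rightarrow> nat \<Rightarrow> nat \<Rightarrow> real) \<Rightarrow> (nat \<Rightarrow> nat \<Rightarrow> real) \<Rightarrow>
   (nat \<Rightarrow> nat \<Rightarrow> real) \<Rightarrow> store \<Rightarrow> nat \<Rightarrow> bool" where
  "generates_transition smp n m P \<pi>\<^sub>0 \<pi> s i \<longleftrightarrow>
     (\<forall>a<m. \<forall>j<n. sample_event smp P \<pi>\<^sub>0 s i a j \<in> sets uniforms \<and>
        measure uniforms (sample_event smp P \<pi>\<^sub>0 s i a j) = \<pi> i a * P a i j)"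

end

theory Submission
  imports Defs
begin

text \<open>
  A distribution on the leaves of a complete binary tree can be sampled by descending from the root,
  provided every inner node stores the total weight of the leaves below it: a random number \<open>r\<close>
  between zero and the total weight goes to the left if it is below the weight of the left child, and
  otherwise goes to the right after that weight has been subtracted.  Leaf \<open>a\<close> is reached exactly
  if \<open>r\<close> lies between the partial sums of the weights before \<open>a\<close> and up to \<open>a\<close>
  (\<open>descend_eq_iff\<close>), so a uniform \<open>r\<close> draws \<open>a\<close> with probability proportional to
  its weight.  Changing one weight by \<open>d\<close> means adding \<open>d\<close> along the path from that leaf
  to the root (\<open>sum_tree_add_path\<close>).  Both operations take time proportional to the depth.

  The memory holds one such tree over the actions for every state, and one tree over the next states
  for every pair of a state and an action.  The policy trees are never renormalized, which would cost
  time linear in the number of actions.  They only have to satisfy that the weights at state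
  \<open>i\<close> are \<open>c i\<close> times the current \<open>\<pi> i\<close>, for some \<open>c i > 0\<close>; the
  factor \<open>c i\<close> is then the weight of the root and can be read off at any time.  The update
  \<open>\<pi> i a \<leftarrow> x\<close> gives leaf \<open>a\<close> the weight \<open>c i * x\<close>, and the
  renormalization is merely a new value of \<open>c i\<close> (\<open>represents_update\<close>).

  Preprocessing starts from the memory filled with zeros, which is a forest of trees of weight zero, and
  inserts every entry of the policy and of the transition probabilities by one path addition, that is
  about \<open>n\<^sup>2 m\<close> additions along paths of logarithmic length.  A transition is two descents
  with two independent uniform numbers, hence the chosen action and next state have the
  product law (\<open>generates_transition_sample_prog\<close>).

  The number of leaves is the power of two that is strictly larger than the number of entries and at most
  twice as large.  It keeps the depth logarithmic, and it leaves a last leaf without an entry: only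
  that leaf can be reached by the random number 1, so that the other leaves correspond exactly
  to half-open intervals.
\<close>


section \<open>Running programs within a time bound\<close>

text \<open>
  A total correctness judgement with a time budget.  Since the machine is deterministic, a proof of it
  also determines the outcome of every given execution (\<open>runs_exec\<close>).
\<close>

definition runs ::
  "(nat \<Rightarrow> nat \<Rightarrow> nat \<Rightarrow> real) \<Rightarrow> (nat \<Rightarrow> nat \<Rightarrow> real) \<Rightarrow> com \<Rightarrow> store \<Rightarrow> nat \<Rightarrow> (store \<Rightarrow> bool) \<Rightarrow> bool"
where
  "runs P \<pi> c s T Q \<longleftrightarrow> (\<exists>t s'. exec P \<pi> c s t s' \<and> t \<le> T \<and> Q s')"

lemma runs_mono:
  "runs P \<pi> c s T Q \<Longrightarrow> T \<le> T' \<Longrightarrow> (\<And>s'. Q s' \<Longrightarrow> Q' s') \<Longrightarrow> runs P \<pi> c s T' Q'"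
  unfolding runs_def by (meson order_trans)

lemma runs_seq:
  assumes "runs P \<pi> c s T R" and "\<And>s'. R s' \<Longrightarrow> runs P \<pi> d s' T' Q"
  shows "runs P \<pi> (Seq c d) s (T + T') Q"
proof -
  from assms(1) obtain t s' where 1: "exec P \<pi> c s t s'" "t \<le> T" "R s'"
    unfolding runs_def by blast
  from assms(2)[OF 1(3)] obtain t' s'' where 2: "exec P \<pi> d s' t' s''" "t' \<le> T'" "Q s''"
    unfolding runs_def by blast
  from exec.Seq[OF 1(1) 2(1)] 1 2 show ?thesis
    unfolding runs_def by (meson add_mono)
qed

lemma runs_exec: "runs P \<pi> c s T Q \<Longrightarrow> exec P \<pi> c s t s' \<Longrightarrow> Q s'"
  unfolding runs_def using exec_deterministic by blast

lemma runs_halts_within: "runs P \<pi> c s T Q \<Longrightarrow> real T \<le> b \<Longrightarrow> halts_within P \<pi> c s b"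
  unfolding runs_def halts_within_def by (meson of_nat_le_iff order_trans)

text \<open>
  The index of the invariant bounds the number of iterations still to come.  An invariant that allows
  an early exit is admitted, so it may be stated with an upper bound in place of the exact number.
\<close>

lemma runs_while:
  assumes body: "\<And>k s. I k s \<Longrightarrow> bval P \<pi> s b \<Longrightarrow> k > 0 \<and> runs P \<pi> c s T (I (k - 1))"
    and exit: "\<And>k s. I k s \<Longrightarrow> \<not> bval P \<pi> s b \<Longrightarrow> Q s"
    and init: "I k s"
  shows "runs P \<pi> (While b c) s (k * (1 + bcost b + T) + 1 + bcost b) Q"
  using init
proof (induction k arbitrary: s)
  case 0
  then have "\<not> bval P \<pi> s b"
    using body by blast
  with 0 show ?case
    unfolding runs_def using exec.WhileFalse exit by force
next
  case (Suc k)
  show ?case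
  proof (cases "bval P \<pi> s b")
    case True
    then obtain t s' where 1: "exec P \<pi> c s t s'" "t \<le> T" "I k s'"
      using body[OF Suc.prems] unfolding runs_def by auto
    from Suc.IH[OF 1(3)] obtain t' s'' where
      2: "exec P \<pi> (While b c) s' t' s''" "t' \<le> k * (1 + bcost b + T) + 1 + bcost b" "Q s''"
      unfolding runs_def by blast
    from exec.WhileTrue[OF True 1(1) 2(1)] 1(2) 2(2,3) show ?thesis
      unfolding runs_def by (intro exI conjI) auto
  next
    case False
    then have "exec P \<pi> (While b c) s (1 + bcost b) s"
      by (rule exec.WhileFalse)
    with False Suc.prems exit show ?thesis
      unfolding runs_def by (intro exI conjI) auto
  qed
qed

text \<open>
  Loop-free code is evaluated by rewriting: \<open>effect\<close> is its final store, and \<open>time_bound\<close>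
  charges both branches of a conditional, which makes it independent of the store.  The equations for
  loops are dummies.
\<close>

fun loop_free :: "com \<Rightarrow> bool" where
  "loop_free (Seq c d) \<longleftrightarrow> loop_free c \<and> loop_free d"
| "loop_free (Cond b c d) \<longleftrightarrow> loop_free c \<and> loop_free d"
| "loop_free (While b c) \<longleftrightarrow> False"
| "loop_free _ \<longleftrightarrow> True"

fun effect ::
  "(nat \<Rightarrow> nat \<Rightarrow> nat \<Rightarrow> real) \<Rightarrow> (nat \<Rightarrow> nat \<Rightarrow> real) \<Rightarrow> com \<Rightarrow> store \<Rightarrow> store" where
  "effect P \<pi> Skip s = s"
| "effect P \<pi> (IStore e f) s = s\<lparr>imem := (imem s)(ival s e := ival s f)\<rparr>"
| "effect P \<pi> (RStore e f) s = s\<lparr>rmem := (rmem s)(ival s e := rval P \<pi> s f)\<rparr>"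
| "effect P \<pi> (Draw e) s = s\<lparr>rmem := (rmem s)(ival s e := rnd s 0), rnd := (\<lambda>k. rnd s (Suc k))\<rparr>"
| "effect P \<pi> (Seq c d) s = effect P \<pi> d (effect P \<pi> c s)"
| "effect P \<pi> (Cond b c d) s = (if bval P \<pi> s b then effect P \<pi> c s else effect P \<pi> d s)"
| "effect P \<pi> (While b c) s = s"

fun time_bound :: "com \<Rightarrow> nat" where
  "time_bound Skip = 1"
| "time_bound (IStore e f) = 1 + icost e + icost f"
| "time_bound (RStore e f) = 1 + icost e + rcost f"
| "time_bound (Draw e) = 1 + icost e"
| "time_bound (Seq c d) = time_bound c + time_bound d"
| "time_bound (Cond b c d) = 1 + bcost b + time_bound c + time_bound d"
| "time_bound (While b c) = 0"

lemma exec_loop_free: "loop_free c \<Longrightarrow> \<exists>t. exec P \<pi> c s t (effect P \<pi> c s) \<and> t \<le> time_bound c"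
proof (induction c arbitrary: s)
  case (Seq c d)
  then obtain t t' where "exec P \<pi> c s t (effect P \<pi> c s)" "t \<le> time_bound c"
    "exec P \<pi> d (effect P \<pi> c s) t' (effect P \<pi> d (effect P \<pi> c s))" "t' \<le> time_bound d"
    by (metis loop_free.simps(1))
  then show ?case
    using exec.Seq by fastforce
next
  case (Cond b c d)
  show ?case
  proof (cases "bval P \<pi> s b")
    case True
    from Cond obtain t where "exec P \<pi> c s t (effect P \<pi> c s)" "t \<le> time_bound c"
      by auto
    with exec.CondTrue[OF True, of c t "effect P \<pi> c s" d] True show ?thesis
      by (intro exI conjI) auto
  next
    case False
    from Cond obtain t where "exec P \<pi> d s t (effect P \<pi> d s)" "t \<le> time_bound d"
      by auto
    with exec.CondFalse[OF False, of d t "effect P \<pi> d s" c] False show ?thesis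
      by (intro exI conjI) auto
  qed
next
  case (IStore e f)
  show ?case using exec.IStore[of P \<pi> e f s] by (intro exI conjI) auto
next
  case (RStore e f)
  show ?case using exec.RStore[of P \<pi> e f s] by (intro exI conjI) auto
next
  case (Draw e)
  show ?case using exec.Draw[of P \<pi> e s] by (intro exI conjI) auto
next
  case Skip
  show ?case using exec.Skip[of P \<pi> s] by (intro exI conjI) auto
qed simp

lemma runs_loop_free:
  "loop_free c \<Longrightarrow> Q (effect P \<pi> c s) \<Longrightarrow> runs P \<pi> c s (time_bound c) Q"
  using exec_loop_free[of c P \<pi> s] unfolding runs_def by blast


section \<open>Sum trees\<close>

text \<open>
  The tree of depth \<open>p\<close> is laid out like a binary heap in the cells from \<open>B\<close> on: the root
  is node 1, the children of \<open>v\<close> are \<open>2 * v\<close> and \<open>2 * v + 1\<close>, and the leaves are the nodes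
  \<open>2 ^ p + l\<close> with \<open>l < 2 ^ p\<close>.  Cell \<open>B\<close> itself, which would be node 0, is not part of it.
\<close>

definition sum_tree :: "nat \<Rightarrow> nat \<Rightarrow> (nat \<Rightarrow> real) \<Rightarrow> (nat \<Rightarrow> real) \<Rightarrow> bool" where
  "sum_tree p B f \<mu> \<longleftrightarrow>
     (\<forall>v. 1 \<le> v \<and> v < 2 ^ p \<longrightarrow> \<mu> (B + v) = \<mu> (B + 2 * v) + \<mu> (B + (2 * v + 1))) \<and>
     (\<forall>l<2 ^ p. \<mu> (B + (2 ^ p + l)) = f l)"

fun add_path :: "nat \<Rightarrow> real \<Rightarrow> nat \<Rightarrow> (nat \<Rightarrow> real) \<Rightarrow> (nat \<Rightarrow> real)" where
  "add_path B d v \<mu> =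
     (if v = 0 then \<mu> else add_path B d (v div 2) (\<mu>(B + v := \<mu> (B + v) + d)))"

declare add_path.simps [simp del]

lemma add_path_outside:
  "x \<le> B \<or> B + v < x \<Longrightarrow> add_path B d v \<mu> x = \<mu> x"
  by (induction B d v \<mu> rule: add_path.induct) (subst add_path.simps, auto)

text \<open>
  Call \<open>\<mu> (B + w) - \<mu> (B + 2 * w) - \<mu> (B + (2 * w + 1))\<close> the defect of \<open>w\<close>, which a sum
  tree keeps at zero.  An addition at \<open>v\<close> changes the defects of \<open>v\<close> and of its parent in opposite
  directions, so along a path to the root everything cancels except at the starting point.  An
  addition that starts in a leaf therefore preserves all sums.
\<close>

lemma add_path_defect:
  fixes B w :: nat
  assumes "w \<ge> 1"
  defines "D \<equiv> \<lambda>\<mu>. \<mu> (B + w) - \<mu> (B + 2 * w) - \<mu> (B + (2 * w + 1)) :: real"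
  shows "D (add_path B d v \<mu>) = D \<mu> + (if w = v then d else 0)"
  using assms(1) unfolding D_def
proof (induction B d v \<mu> rule: add_path.induct)
  case (1 B d v \<mu>)
  show ?case
  proof (cases "v = 0")
    case True
    with 1 show ?thesis by (simp add: add_path.simps)
  next
    case False
    define \<mu>' where "\<mu>' = \<mu>(B + v := \<mu> (B + v) + d)"
    have upd: "\<mu>' (B + x) = \<mu> (B + x) + (if x = v then d else 0)" for x
      by (simp add: \<mu>'_def)
    \<comment> \<open>The addition at \<open>v\<close> lowers the defect of the parent of \<open>v\<close> by \<open>d\<close>, and the
      induction hypothesis raises it again.\<close>
    have children: "(2 * w = v \<or> 2 * w + 1 = v) \<longleftrightarrow> w = v div 2"
      by presburger
    have "add_path B d v \<mu> = add_path B d (v div 2) \<mu>'"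
      using False by (subst add_path.simps) (simp add: \<mu>'_def)
    with 1(1)[OF False 1(2), folded \<mu>'_def] children False 1(2) show ?thesis
      unfolding upd by (auto split: if_splits)
  qed
qed

lemma add_path_leaf:
  assumes "v \<ge> 1" "v div 2 < w"
  shows "add_path B d v \<mu> (B + w) = \<mu> (B + w) + (if w = v then d else 0)"
  using assms by (subst add_path.simps) (auto simp: add_path_outside)

lemma sum_tree_add_path:
  assumes "sum_tree p B f \<mu>" "a < 2 ^ p"
  shows "sum_tree p B (f(a := f a + d)) (add_path B d (2 ^ p + a) \<mu>)"
  unfolding sum_tree_def
proof (intro conjI allI impI)
  fix v :: nat
  assume v: "1 \<le> v \<and> v < 2 ^ p"
  with assms(1) have "\<mu> (B + v) = \<mu> (B + 2 * v) + \<mu> (B + (2 * v + 1))"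
    by (simp add: sum_tree_def)
  with add_path_defect[of v B d "2 ^ p + a" \<mu>] v
  show "add_path B d (2 ^ p + a) \<mu> (B + v) =
      add_path B d (2 ^ p + a) \<mu> (B + 2 * v) + add_path B d (2 ^ p + a) \<mu> (B + (2 * v + 1))"
    by simp
next
  fix l :: nat
  assume l: "l < 2 ^ p"
  have "(2 ^ p + a) div 2 < 2 ^ p + l"
    using assms(2) by linarith
  moreover have "1 \<le> 2 ^ p + a"
    by (simp add: Suc_le_eq)
  ultimately show "add_path B d (2 ^ p + a) \<mu> (B + (2 ^ p + l)) = (f(a := f a + d)) l"
    using assms(1) l by (simp add: add_path_leaf sum_tree_def)
qed

lemma sum_tree_cong:
  assumes "\<And>v. 1 \<le> v \<Longrightarrow> v < 2 ^ Suc p \<Longrightarrow> \<mu>' (B + v) = \<mu> (B + v)"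
  shows "sum_tree p B f \<mu>' \<longleftrightarrow> sum_tree p B f \<mu>"
proof -
  have "\<mu>' (B + v) = \<mu> (B + v)" "\<mu>' (B + 2 * v) = \<mu> (B + 2 * v)"
    "\<mu>' (B + (2 * v + 1)) = \<mu> (B + (2 * v + 1))" if "1 \<le> v" "v < 2 ^ p" for v
    using that assms[of v] assms[of "2 * v"] assms[of "2 * v + 1"] by auto
  moreover have "\<mu>' (B + (2 ^ p + l)) = \<mu> (B + (2 ^ p + l))" if "l < 2 ^ p" for l
    using that assms[of "2 ^ p + l"] by (auto simp: Suc_le_eq)
  ultimately show ?thesis
    unfolding sum_tree_def by auto
qed

text \<open>
  The condition \<open>2 ^ p \<le> v * 2 ^ h \<and> v * 2 ^ h < 2 ^ Suc p\<close> says that node \<open>v\<close> has height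
  \<open>h\<close>; the leaves below it are then the nodes from \<open>v * 2 ^ h\<close> up to, but excluding,
  \<open>(v + 1) * 2 ^ h\<close>.
\<close>

lemma right_child_in_range:
  assumes "2 ^ p \<le> v * 2 ^ Suc h" "v * 2 ^ Suc h < (2::nat) ^ Suc p"
  shows "(2 * v + 1) * 2 ^ h < 2 ^ Suc p"
proof -
  have "v \<ge> 1"
    using assms(1) by (cases v) auto
  have hp: "h < p"
  proof (rule ccontr)
    assume "\<not> h < p"
    then have "(2::nat) ^ Suc p \<le> 2 ^ Suc h" by (intro power_increasing) auto
    with \<open>v \<ge> 1\<close> assms(2) show False
      by (metis leD mult_le_mono1 nat_mult_1 order_trans)
  qed
  then have "(2::nat) ^ Suc p = 2 ^ (p - h) * 2 ^ Suc h"
    by (simp flip: power_add)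
  with assms(2) have "v < 2 ^ (p - h)"
    by (metis mult_less_cancel2)
  then have "2 * v + 1 < 2 * 2 ^ (p - h)" by linarith
  then have "(2 * v + 1) * 2 ^ h < 2 * 2 ^ (p - h) * 2 ^ h"
    by (rule mult_strict_right_mono) simp
  also have "\<dots> = 2 ^ Suc p" using hp by (simp flip: power_add)
  finally show ?thesis .
qed

lemma sum_tree_block:
  assumes "sum_tree p B f \<mu>" "2 ^ p \<le> v * 2 ^ h" "v * 2 ^ h < 2 ^ Suc p"
  shows "\<mu> (B + v) = (\<Sum>l = v * 2 ^ h..<(v + 1) * 2 ^ h. \<mu> (B + l))"
  using assms(2,3)
proof (induction h arbitrary: v)
  case 0
  then show ?case by simp
next
  case (Suc h)
  have "v \<ge> 1"
    using Suc.prems by (cases v) auto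
  moreover have "v < 2 ^ p"
  proof (rule le_less_trans)
    show "v \<le> v * 2 ^ h" by simp
    show "v * 2 ^ h < 2 ^ p" using Suc.prems(2) by simp
  qed
  ultimately have "\<mu> (B + v) = \<mu> (B + 2 * v) + \<mu> (B + (2 * v + 1))"
    using assms(1) by (simp add: sum_tree_def)
  moreover have "\<mu> (B + 2 * v) = (\<Sum>l = 2 * v * 2 ^ h..<(2 * v + 1) * 2 ^ h. \<mu> (B + l))"
    using Suc.IH[of "2 * v"] Suc.prems by (simp add: mult_ac)
  moreover have "\<mu> (B + (2 * v + 1)) =
      (\<Sum>l = (2 * v + 1) * 2 ^ h..<(2 * v + 2) * 2 ^ h. \<mu> (B + l))"
    using Suc.IH[of "2 * v + 1"] Suc.prems right_child_in_range[OF Suc.prems]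
    by (simp add: algebra_simps)
  ultimately show ?case
    by (subst sum.atLeastLessThan_concat[of "v * 2 ^ Suc h" "(2 * v + 1) * 2 ^ h", symmetric])
      (simp_all add: algebra_simps)
qed

lemma sum_tree_root:
  assumes "sum_tree p B f \<mu>"
  shows "\<mu> (B + 1) = (\<Sum>l<2 ^ p. f l)"
proof -
  have "\<mu> (B + 1) = (\<Sum>l = 0 + 2 ^ p..<2 ^ p + 2 ^ p. \<mu> (B + l))"
    using sum_tree_block[OF assms, of 1 p] by (simp add: mult_2)
  also have "\<dots> = (\<Sum>l<2 ^ p. \<mu> (B + (2 ^ p + l)))"
    unfolding sum.shift_bounds_nat_ivl by (simp add: lessThan_atLeast0 add_ac)
  also have "\<dots> = (\<Sum>l<2 ^ p. f l)"
    using assms by (intro sum.cong) (auto simp: sum_tree_def)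
  finally show ?thesis .
qed

fun descend :: "nat \<Rightarrow> (nat \<Rightarrow> real) \<Rightarrow> nat \<Rightarrow> nat \<Rightarrow> real \<Rightarrow> nat" where
  "descend B \<mu> 0 v r = v"
| "descend B \<mu> (Suc h) v r =
     (if r < \<mu> (B + 2 * v) then descend B \<mu> h (2 * v) r
      else descend B \<mu> h (2 * v + 1) (r - \<mu> (B + 2 * v)))"

lemma descend_cong:
  assumes "\<And>x. x \<ge> B \<Longrightarrow> \<mu>' x = \<mu> x"
  shows "descend B \<mu>' h v r = descend B \<mu> h v r"
  by (induction h arbitrary: v r) (auto simp: assms)

lemma descend_ge: "v * 2 ^ h \<le> descend B \<mu> h v r"
proof (induction h arbitrary: v r)
  case (Suc h)
  show ?case
    using Suc[of "2 * v" r] Suc[of "2 * v + 1" "r - \<mu> (B + 2 * v)"] by (auto simp: algebra_simps)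
qed simp

text \<open>
  The remaining number in a descent is the original \<open>r\<close> minus the weight of all leaves to the left
  of the current node.  Hence \<open>r\<close> stays between the partial sums at the two ends of the block of leaves
  below that node; at the right border of the tree there is no upper bound.
\<close>

lemma descend_bracket:
  fixes p B :: nat and \<mu> :: "nat \<Rightarrow> real"
  defines "S \<equiv> \<lambda>k. \<Sum>l = 2 ^ p..<k. \<mu> (B + l)"
  assumes tree: "sum_tree p B f \<mu>"
    and "2 ^ p \<le> v * 2 ^ h" "v * 2 ^ h < 2 ^ Suc p"
    and "S (v * 2 ^ h) \<le> r" "r < S ((v + 1) * 2 ^ h) \<or> (v + 1) * 2 ^ h = 2 ^ Suc p"
    and "l = descend B \<mu> h v (r - S (v * 2 ^ h))"
  shows "2 ^ p \<le> l \<and> l < 2 ^ Suc p \<and> S l \<le> r \<and> (r < S (l + 1) \<or> l + 1 = 2 ^ Suc p)"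
  using assms(3-)
proof (induction h arbitrary: v)
  case 0
  then show ?case by simp
next
  case (Suc h)
  define x y z where "x = 2 * v * 2 ^ h" and "y = (2 * v + 1) * 2 ^ h"
    and "z = (2 * v + 1 + 1) * 2 ^ h"
  have ends: "v * 2 ^ Suc h = x" "(v + 1) * 2 ^ Suc h = z"
    by (simp_all add: x_def z_def)
  have left: "2 ^ p \<le> x" "x < 2 ^ Suc p" and right: "2 ^ p \<le> y" "y < 2 ^ Suc p" and "x \<le> y"
    using Suc.prems(1,2) right_child_in_range[of p v h] by (auto simp: x_def y_def algebra_simps)
  have split: "\<mu> (B + 2 * v) = S y - S x"
    using sum_tree_block[OF tree, of "2 * v" h]
      sum.atLeastLessThan_concat[of "2 ^ p" x y "\<lambda>l. \<mu> (B + l)"] left \<open>x \<le> y\<close>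
    unfolding S_def x_def[symmetric] y_def[symmetric] by simp
  note IH = Suc.IH[of "2 * v", folded x_def y_def] Suc.IH[of "2 * v + 1", folded y_def z_def]
  show ?case
  proof (cases "r < S y")
    case True
    then show ?thesis
      using Suc.prems left split unfolding ends by (intro IH(1)) auto
  next
    case False
    then show ?thesis
      using Suc.prems right split unfolding ends by (intro IH(2)) auto
  qed
qed

text \<open>
  Partial sums of nonnegative weights are monotone, so their brackets overlap nowhere and
  \<open>descend_bracket\<close> determines the leaf.  The last leaf is excluded because it also receives
  all numbers beyond the total weight.
\<close>

lemma descend_eq_iff:
  assumes tree: "sum_tree p B f \<mu>" and nonneg: "\<And>l. l < 2 ^ p \<Longrightarrow> f l \<ge> 0"
    and "0 \<le> r" "a + 1 < 2 ^ p"
  shows "descend B \<mu> p 1 r = 2 ^ p + a \<longleftrightarrow> (\<Sum>l<a. f l) \<le> r \<and> r < (\<Sum>l<a + 1. f l)"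
proof -
  define S where "S k = (\<Sum>l = 2 ^ p..<k. \<mu> (B + l))" for k
  have S_leaf: "S (2 ^ p + k) = (\<Sum>l<k. f l)" if "k \<le> 2 ^ p" for k
  proof -
    have "S (2 ^ p + k) = (\<Sum>l = 0 + 2 ^ p..<k + 2 ^ p. \<mu> (B + l))"
      by (simp add: S_def add.commute)
    also have "\<dots> = (\<Sum>l<k. \<mu> (B + (2 ^ p + l)))"
      unfolding sum.shift_bounds_nat_ivl by (simp add: lessThan_atLeast0 add_ac)
    also have "\<dots> = (\<Sum>l<k. f l)"
      using tree that by (intro sum.cong) (auto simp: sum_tree_def)
    finally show ?thesis .
  qed
  define b where "b = descend B \<mu> p 1 r - 2 ^ p"
  have "2 ^ p \<le> descend B \<mu> p 1 r \<and> descend B \<mu> p 1 r < 2 ^ Suc p \<and> S (descend B \<mu> p 1 r) \<le> r \<and>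
      (r < S (descend B \<mu> p 1 r + 1) \<or> descend B \<mu> p 1 r + 1 = 2 ^ Suc p)"
    using \<open>0 \<le> r\<close> unfolding S_def
    by (intro descend_bracket[OF tree, where v = 1 and h = p]) auto
  then have b: "descend B \<mu> p 1 r = 2 ^ p + b" "b < 2 ^ p" "S (2 ^ p + b) \<le> r"
    "r < S (2 ^ p + (b + 1)) \<or> b + 1 = 2 ^ p"
    unfolding b_def by auto
  have mono: "(\<Sum>l<j. f l) \<le> (\<Sum>l<k. f l)" if "j \<le> k" "k \<le> 2 ^ p" for j k
    using that nonneg by (intro sum_mono2) auto
  show ?thesis
  proof
    assume "descend B \<mu> p 1 r = 2 ^ p + a"
    with b have "a = b" by simp
    with b assms(4) S_leaf[of b] S_leaf[of "b + 1"]
    show "(\<Sum>l<a. f l) \<le> r \<and> r < (\<Sum>l<a + 1. f l)" by auto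
  next
    assume a: "(\<Sum>l<a. f l) \<le> r \<and> r < (\<Sum>l<a + 1. f l)"
    have "\<not> a + 1 \<le> b"
      using a b(2,3) mono[of "a + 1" b] S_leaf[of b] by auto
    moreover have "\<not> b + 1 \<le> a"
      using a b(4) assms(4) mono[of "b + 1" a] S_leaf[of "b + 1"] by auto
    ultimately show "descend B \<mu> p 1 r = 2 ^ p + a"
      using b(1) by simp
  qed
qed

text \<open>
  This is why unnormalized weights suffice: the random number is scaled by the weight of the root, and the
  common factor \<open>c\<close> cancels.
\<close>

lemma descend_scaled_iff:
  assumes tree: "sum_tree p B (\<lambda>l. if l < m then c * f l else 0) \<mu>"
    and "c > 0" "\<And>l. l < m \<Longrightarrow> f l \<ge> 0" "(\<Sum>l<m. f l) = 1"
    and "a < m" "m < 2 ^ p" "0 \<le> r"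
  shows "descend B \<mu> p 1 (r * \<mu> (B + 1)) - 2 ^ p = a \<longleftrightarrow> r \<in> {(\<Sum>l<a. f l)..<(\<Sum>l<a + 1. f l)}"
proof -
  let ?w = "\<lambda>l. if l < m then c * f l else 0"
  have "\<mu> (B + 1) = (\<Sum>l<2 ^ p. ?w l)"
    by (rule sum_tree_root[OF tree])
  also have "\<dots> = (\<Sum>l<m. ?w l)"
    using assms by (intro sum.mono_neutral_right) auto
  also have "\<dots> = c * (\<Sum>l<m. f l)"
    by (simp add: sum_distrib_left)
  finally have root: "\<mu> (B + 1) = c"
    using assms by simp
  have part: "(\<Sum>l<k. ?w l) = c * (\<Sum>l<k. f l)" if "k \<le> m" for k
    unfolding sum_distrib_left using that by (intro sum.cong) auto
  have "descend B \<mu> p 1 (r * c) - 2 ^ p = a \<longleftrightarrow> descend B \<mu> p 1 (r * c) = 2 ^ p + a"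
    using descend_ge[of 1 p B \<mu> "r * c"] by auto
  also have "\<dots> \<longleftrightarrow> (\<Sum>l<a. ?w l) \<le> r * c \<and> r * c < (\<Sum>l<a + 1. ?w l)"
    using assms by (intro descend_eq_iff[OF tree]) auto
  also have "\<dots> \<longleftrightarrow> c * (\<Sum>l<a. f l) \<le> c * r \<and> c * r < c * (\<Sum>l<a + 1. f l)"
    using part[of a] part[of "a + 1"] \<open>a < m\<close> by (simp add: mult.commute)
  finally show ?thesis
    using \<open>c > 0\<close> unfolding root by simp
qed


section \<open>A forest of sum trees in one array\<close>

text \<open>
  Slot \<open>b = 0\<close> of state \<open>i\<close> holds the tree over the actions, slot \<open>b = a + 1\<close> the tree over
  the next states after action \<open>a\<close>.  The last factor exceeds every node number in either kind of tree,
  and the summand 1 keeps the cells below the first slot free for registers.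
\<close>

definition slot :: "nat \<Rightarrow> nat \<Rightarrow> nat \<Rightarrow> nat \<Rightarrow> nat \<Rightarrow> nat" where
  "slot m p q i b = (1 + i * (m + 1) + b) * (2 * (2 ^ p + 2 ^ q))"

text \<open>
  \<open>w i\<close> are the weights in the tree over actions of state \<open>i\<close>, and \<open>K i a\<close> those in the tree
  over next states of state \<open>i\<close> and action \<open>a\<close>.
\<close>

definition forest ::
  "nat \<Rightarrow> nat \<Rightarrow> nat \<Rightarrow> nat \<Rightarrow> (nat \<Rightarrow> nat \<Rightarrow> real) \<Rightarrow> (nat \<Rightarrow> nat \<Rightarrow> nat \<Rightarrow> real) \<Rightarrow>
   (nat \<Rightarrow> real) \<Rightarrow> bool" where
  "forest n m p q w K \<mu> \<longleftrightarrow>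
     (\<forall>i<n. sum_tree p (slot m p q i 0) (w i) \<mu> \<and>
        (\<forall>a<m. sum_tree q (slot m p q i (a + 1)) (K i a) \<mu>))"

lemma slot_ge: "4 \<le> slot m p q i b"
proof -
  have "1 + 1 \<le> (2::nat) ^ p + 2 ^ q"
    by (intro add_mono) simp_all
  then have "4 \<le> 2 * ((2::nat) ^ p + 2 ^ q)" by simp
  also have "\<dots> \<le> slot m p q i b"
    by (simp add: slot_def)
  finally show ?thesis .
qed

lemma slot_disjoint:
  assumes "slot m p q i b + v = slot m p q i' b' + v'" "b \<le> m" "b' \<le> m"
    and "v < 2 * (2 ^ p + 2 ^ q)" "v' < 2 * (2 ^ p + 2 ^ q)"
  shows "i = i' \<and> b = b'"
proof -
  let ?L = "2 * (2 ^ p + 2 ^ q) :: nat"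
  have quot: "(t * ?L + v) div ?L = t" if "v < ?L" for t v
    using that by (simp add: div_mult_self3)
  have "(1 + i * (m + 1) + b) * ?L + v = (1 + i' * (m + 1) + b') * ?L + v'"
    using assms(1) by (simp only: slot_def)
  then have "1 + i * (m + 1) + b = 1 + i' * (m + 1) + b'"
    by (metis quot assms(4,5))
  then have eq: "i * (m + 1) + b = i' * (m + 1) + b'" by simp
  have "(i * (m + 1) + b) div (m + 1) = i" "(i' * (m + 1) + b') div (m + 1) = i'"
    using assms(2,3) by (simp_all add: div_mult_self3 del: mult_Suc_right)
  with eq show ?thesis by simp
qed

lemma sum_tree_add_path_other_slot:
  assumes "(i, b) \<noteq> (i', b')" "b \<le> m" "b' \<le> m" "r \<in> {p, q}" "v < 2 * (2 ^ p + 2 ^ q)"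
  shows "sum_tree r (slot m p q i' b') f (add_path (slot m p q i b) d v \<mu>) \<longleftrightarrow>
    sum_tree r (slot m p q i' b') f \<mu>"
proof (rule sum_tree_cong)
  fix w :: nat
  assume w: "1 \<le> w" "w < 2 ^ Suc r"
  let ?x = "slot m p q i' b' + w"
  have "w < 2 * (2 ^ p + 2 ^ q)"
    using w(2) assms(4) by auto
  then have "?x \<noteq> slot m p q i b + u" if "u \<le> v" for u
    using slot_disjoint[of m p q i' b' w i b u] that assms by auto
  then have "?x \<le> slot m p q i b \<or> slot m p q i b + v < ?x"
    by (metis le_add_diff_inverse linorder_le_cases nat_le_linear not_le add_le_cancel_left)
  then show "add_path (slot m p q i b) d v \<mu> ?x = \<mu> ?x"
    by (rule add_path_outside)
qed

lemma forest_add_policy: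
  assumes "forest n m p q w K \<mu>" "i < n" "a < 2 ^ p"
  shows "forest n m p q (w(i := (w i)(a := w i a + d))) K (add_path (slot m p q i 0) d (2 ^ p + a) \<mu>)"
proof -
  have "2 ^ p + a < 2 * (2 ^ p + (2::nat) ^ q)"
    using assms(3) by simp
  then show ?thesis
    using assms sum_tree_add_path[of p "slot m p q i 0" "w i" \<mu> a d] unfolding forest_def
    by (auto simp: sum_tree_add_path_other_slot)
qed

lemma forest_add_kernel:
  assumes "forest n m p q w K \<mu>" "i < n" "a < m" "j < 2 ^ q"
  shows "forest n m p q w (K(i := (K i)(a := (K i a)(j := K i a j + d))))
    (add_path (slot m p q i (a + 1)) d (2 ^ q + j) \<mu>)"
proof -
  have "2 ^ q + j < 2 * (2 ^ p + (2::nat) ^ q)"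
    using assms(4) by simp
  then show ?thesis
    using assms sum_tree_add_path[of q "slot m p q i (a + 1)" "K i a" \<mu> j d] unfolding forest_def
    by (auto simp: sum_tree_add_path_other_slot)
qed

text \<open>
  The register cells 0 and 1 lie below every slot.
\<close>

lemma forest_cong:
  assumes "\<And>x. x \<ge> 2 \<Longrightarrow> \<mu>' x = \<mu> x"
  shows "forest n m p q w K \<mu>' \<longleftrightarrow> forest n m p q w K \<mu>"
proof -
  have "\<mu>' (slot m p q i b + v) = \<mu> (slot m p q i b + v)" for i b v
    using slot_ge[of m p q i b] by (intro assms) linarith
  then show ?thesis
    unfolding forest_def using sum_tree_cong[of _ \<mu>' _ \<mu>] by metis
qed


section \<open>The programs\<close>

text \<open>
  Cells 0 and 1 of the natural memory carry arguments and results.  The cells 2 to 5 keep the sizes of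
  the problem and of the trees between calls; the cells from 6 on are scratch.  Of the real memory, cell
  0 is the argument and cell 1 the only scratch cell; the trees lie above both.
\<close>

abbreviation (input) r_states :: nat where "r_states \<equiv> 2"
abbreviation (input) r_actions :: nat where "r_actions \<equiv> 3"
abbreviation (input) r_action_leaves :: nat where "r_action_leaves \<equiv> 4"
abbreviation (input) r_state_leaves :: nat where "r_state_leaves \<equiv> 5"
abbreviation (input) r_base :: nat where "r_base \<equiv> 6"
abbreviation (input) r_node :: nat where "r_node \<equiv> 7"
abbreviation (input) r_leaves :: nat where "r_leaves \<equiv> 8"
abbreviation (input) r_i :: nat where "r_i \<equiv> 9"
abbreviation (input) r_a :: nat where "r_a \<equiv> 10"
abbreviation (input) r_j :: nat where "r_j \<equiv> 11"

abbreviation reg :: "nat \<Rightarrow> iexp" where "reg k \<equiv> ILoad (IConst k)"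
abbreviation set_reg :: "nat \<Rightarrow> iexp \<Rightarrow> com" where "set_reg k e \<equiv> IStore (IConst k) e"
abbreviation then_do :: "com \<Rightarrow> com \<Rightarrow> com" (infixr ";;" 60) where "c ;; d \<equiv> Seq c d"

abbreviation real_reg :: rexp where "real_reg \<equiv> RLoad (IConst 1)"
abbreviation set_real_reg :: "rexp \<Rightarrow> com" where "set_real_reg e \<equiv> RStore (IConst 1) e"
abbreviation cell :: "iexp \<Rightarrow> iexp" where "cell v \<equiv> IAdd (reg r_base) v"
abbreviation left_child :: iexp where "left_child \<equiv> IMul (IConst 2) (reg r_node)"

definition slot_exp :: "iexp \<Rightarrow> iexp \<Rightarrow> iexp" where
  "slot_exp i b = IMul (IAdd (IAdd (IConst 1) (IMul i (IAdd (reg r_actions) (IConst 1)))) b)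
     (IMul (IConst 2) (IAdd (reg r_action_leaves) (reg r_state_leaves)))"

text \<open>
  Implements \<open>add_path\<close> for the tree at \<open>r_base\<close>, the starting node in \<open>r_node\<close> and the
  increment in the real register.
\<close>

definition add_to_leaf :: com where
  "add_to_leaf =
     While (ILess (IConst 0) (reg r_node))
       (RStore (cell (reg r_node)) (RAdd (RLoad (cell (reg r_node))) real_reg) ;;
        set_reg r_node (IDiv (reg r_node) (IConst 2)))"

definition descend_loop :: com where
  "descend_loop =
     While (ILess (reg r_node) (reg r_leaves))
       (Cond (RLess real_reg (RLoad (cell left_child)))
         (set_reg r_node left_child)
         (set_real_reg (RSub real_reg (RLoad (cell left_child))) ;;
          set_reg r_node (IAdd left_child (IConst 1))))"

text \<open>
  The assignments are grouped before the loop so that they form one loop-free block.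
\<close>

definition draw_leaf :: "iexp \<Rightarrow> iexp \<Rightarrow> com" where
  "draw_leaf base leaves =
     (set_reg r_base base ;; set_reg r_leaves leaves ;; set_reg r_node (IConst 1) ;;
      Draw (IConst 1) ;; set_real_reg (RMul real_reg (RLoad (cell (IConst 1))))) ;;
     descend_loop"

definition sample_prog :: com where
  "sample_prog =
     draw_leaf (slot_exp (reg 0) (IConst 0)) (reg r_action_leaves) ;;
     set_reg r_a (ISub (reg r_node) (reg r_action_leaves)) ;;
     draw_leaf (slot_exp (reg 0) (IAdd (reg r_a) (IConst 1))) (reg r_state_leaves) ;;
     set_reg 0 (reg r_a) ;;
     set_reg 1 (ISub (reg r_node) (reg r_state_leaves))"

text \<open>
  The root of the tree supplies the factor \<open>c\<close> between stored weights and probabilities, so the leaf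
  must become \<open>c * x\<close>; the increment is the difference to its old weight.
\<close>

definition update_prog :: com where
  "update_prog =
     (set_reg r_base (slot_exp (reg 0) (IConst 0)) ;;
      set_reg r_node (IAdd (reg r_action_leaves) (reg 1)) ;;
      set_real_reg (RSub (RMul (RLoad (IConst 0)) (RLoad (cell (IConst 1))))
        (RLoad (cell (reg r_node))))) ;;
     add_to_leaf"

text \<open>
  Computes the least power of two that exceeds the value in \<open>source\<close>.
\<close>

definition round_up :: "nat \<Rightarrow> nat \<Rightarrow> com" where
  "round_up target source =
     set_reg target (IConst 1) ;;
     While (ILess (reg target) (IAdd (reg source) (IConst 1)))
       (set_reg target (IMul (IConst 2) (reg target)))"

definition load_kernel_row :: com where
  "load_kernel_row =
     While (ILess (reg r_j) (reg r_states))
       ((set_reg r_node (IAdd (reg r_state_leaves) (reg r_j)) ;;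
         set_real_reg (QueryP (reg r_a) (reg r_i) (reg r_j))) ;;
        add_to_leaf ;;
        set_reg r_j (IAdd (reg r_j) (IConst 1)))"

definition load_actions :: com where
  "load_actions =
     While (ILess (reg r_a) (reg r_actions))
       ((set_reg r_base (slot_exp (reg r_i) (IConst 0)) ;;
         set_reg r_node (IAdd (reg r_action_leaves) (reg r_a)) ;;
         set_real_reg (QueryPol (reg r_i) (reg r_a))) ;;
        add_to_leaf ;;
        (set_reg r_base (slot_exp (reg r_i) (IAdd (reg r_a) (IConst 1))) ;;
         set_reg r_j (IConst 0)) ;;
        load_kernel_row ;;
        set_reg r_a (IAdd (reg r_a) (IConst 1)))"

definition load_states :: com where
  "load_states =
     While (ILess (reg r_i) (reg r_states))
       (set_reg r_a (IConst 0) ;;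
        load_actions ;;
        set_reg r_i (IAdd (reg r_i) (IConst 1)))"

definition preprocess_prog :: com where
  "preprocess_prog =
     (set_reg r_states (reg 0) ;; set_reg r_actions (reg 1)) ;;
     round_up r_action_leaves r_actions ;;
     round_up r_state_leaves r_states ;;
     set_reg r_i (IConst 0) ;;
     load_states"


section \<open>Effect and cost of the programs\<close>

lemma ival_slot_exp:
  assumes "imem s r_actions = m" "imem s r_action_leaves = 2 ^ p" "imem s r_state_leaves = 2 ^ q"
  shows "ival s (slot_exp i b) = slot m p q (ival s i) (ival s b)"
  using assms by (simp add: slot_exp_def slot_def)

lemma icost_slot_exp: "icost (slot_exp i b) = icost i + icost b + 16"
  by (simp add: slot_exp_def)

text \<open>
  The constants in this and the following time bounds add up the costs of single commands, mostly
  rounded up.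
\<close>

lemma runs_add_to_leaf:
  assumes "imem s r_node < 2 ^ k" "imem s r_base \<ge> 1"
  shows "runs P \<pi> add_to_leaf s (26 * k + 5)
    (\<lambda>s'. imem s' = (imem s)(r_node := 0) \<and>
       rmem s' = add_path (imem s r_base) (rmem s 1) (imem s r_node) (rmem s))"
proof -
  \<comment> \<open>Halving the node lowers the exponent by one; the additions still to be done lead to the same
    memory as all additions from the start.\<close>
  define I where "I k s' \<longleftrightarrow> imem s' r_node < 2 ^ k \<and> (\<forall>x. x \<noteq> r_node \<longrightarrow> imem s' x = imem s x) \<and>
    rmem s' 1 = rmem s 1 \<and>
    add_path (imem s r_base) (rmem s 1) (imem s' r_node) (rmem s') =
      add_path (imem s r_base) (rmem s 1) (imem s r_node) (rmem s)" for k and s' :: store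
  let ?b = "ILess (IConst 0) (reg r_node)"
  let ?c = "RStore (cell (reg r_node)) (RAdd (RLoad (cell (reg r_node))) real_reg) ;;
        set_reg r_node (IDiv (reg r_node) (IConst 2))"
  have "runs P \<pi> (While ?b ?c) s (k * (1 + bcost ?b + time_bound ?c) + 1 + bcost ?b)
    (\<lambda>s'. imem s' = (imem s)(r_node := 0) \<and>
       rmem s' = add_path (imem s r_base) (rmem s 1) (imem s r_node) (rmem s))"
  proof (rule runs_while[where I = I])
    fix k s'
    assume I: "I k s'" and "bval P \<pi> s' ?b"
    then have pos: "imem s' r_node > 0" by simp
    then have "k > 0"
      using I by (cases k) (auto simp: I_def)
    moreover have "I (k - 1) (effect P \<pi> ?c s')"
      using I pos assms(2) \<open>k > 0\<close> unfolding I_def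
      by (subst (asm) add_path.simps) (cases k, auto)
    ultimately show "k > 0 \<and> runs P \<pi> ?c s' (time_bound ?c) (I (k - 1))"
      by (auto intro!: runs_loop_free simp del: effect.simps time_bound.simps)
  next
    fix k s'
    assume "I k s'" "\<not> bval P \<pi> s' ?b"
    then show "imem s' = (imem s)(r_node := 0) \<and>
       rmem s' = add_path (imem s r_base) (rmem s 1) (imem s r_node) (rmem s)"
      unfolding I_def by (auto simp: add_path.simps[of _ _ 0])
  next
    show "I k s" using assms(1) by (simp add: I_def)
  qed
  then show ?thesis
    unfolding add_to_leaf_def by (rule runs_mono) auto
qed

text \<open>
  Nothing is assumed about the stored weights: the time bound is also needed after an exceptional first
  draw, when the leaf reached belongs to no action and the second descent reads cells of no
  particular meaning.
\<close>

lemma runs_descend_loop: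
  assumes "imem s r_node = 1" "imem s r_leaves = 2 ^ p" "imem s r_base \<ge> 2"
  shows "runs P \<pi> descend_loop s (50 * p + 10)
    (\<lambda>s'. imem s' = (imem s)(r_node := descend (imem s r_base) (rmem s) p 1 (rmem s 1)) \<and>
       (\<forall>x. x \<noteq> 1 \<longrightarrow> rmem s' x = rmem s x) \<and> rnd s' = rnd s)"
proof -
  let ?B = "imem s r_base"
  let ?Q = "\<lambda>s'. imem s' = (imem s)(r_node := descend ?B (rmem s) p 1 (rmem s 1)) \<and>
       (\<forall>x. x \<noteq> 1 \<longrightarrow> rmem s' x = rmem s x) \<and> rnd s' = rnd s"
  \<comment> \<open>The number of remaining iterations is the height of the current node.\<close>
  define I where "I h s' \<longleftrightarrow> 2 ^ p \<le> imem s' r_node * 2 ^ h \<and> imem s' r_node * 2 ^ h < 2 ^ Suc p \<and>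
    (\<forall>x. x \<noteq> r_node \<longrightarrow> imem s' x = imem s x) \<and>
    (\<forall>x. x \<noteq> 1 \<longrightarrow> rmem s' x = rmem s x) \<and> rnd s' = rnd s \<and>
    descend ?B (rmem s) h (imem s' r_node) (rmem s' 1) = descend ?B (rmem s) p 1 (rmem s 1)"
    for h and s' :: store
  let ?b = "ILess (reg r_node) (reg r_leaves)"
  let ?c = "Cond (RLess real_reg (RLoad (cell left_child)))
         (set_reg r_node left_child)
         (set_real_reg (RSub real_reg (RLoad (cell left_child))) ;;
          set_reg r_node (IAdd left_child (IConst 1)))"
  have "runs P \<pi> (While ?b ?c) s (p * (1 + bcost ?b + time_bound ?c) + 1 + bcost ?b) ?Q"
  proof (rule runs_while[where I = I])
    fix h s'
    assume I: "I h s'" and "bval P \<pi> s' ?b"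
    then have less: "imem s' r_node < 2 ^ p"
      using assms(2) by (simp add: I_def)
    then have "h > 0"
      using I by (cases h) (auto simp: I_def)
    then obtain g where g: "h = Suc g" by (cases h) auto
    have "(2 * imem s' r_node + 1) * 2 ^ g < 2 ^ Suc p"
      using I unfolding I_def g by (intro right_child_in_range) auto
    then have "I (h - 1) (effect P \<pi> ?c s')"
      using I assms(3) unfolding I_def g
      by (auto simp: algebra_simps split: if_splits)
    with \<open>h > 0\<close> show "h > 0 \<and> runs P \<pi> ?c s' (time_bound ?c) (I (h - 1))"
      by (auto intro!: runs_loop_free simp del: effect.simps time_bound.simps)
  next
    fix h s'
    assume I: "I h s'" and exit: "\<not> bval P \<pi> s' ?b"
    have "h = 0"
    proof (rule ccontr)
      assume "h \<noteq> 0"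
      then have "2 * imem s' r_node \<le> imem s' r_node * 2 ^ h"
        by (cases h) auto
      with I exit assms(2) show False by (auto simp: I_def)
    qed
    with I show "?Q s'"
      unfolding I_def by auto
  next
    show "I p s" using assms by (simp add: I_def)
  qed
  then show ?thesis
    unfolding descend_loop_def by (rule runs_mono) auto
qed

definition configured :: "nat \<Rightarrow> nat \<Rightarrow> nat \<Rightarrow> nat \<Rightarrow> store \<Rightarrow> bool" where
  "configured n m p q s \<longleftrightarrow> imem s r_states = n \<and> imem s r_actions = m \<and>
     imem s r_action_leaves = 2 ^ p \<and> imem s r_state_leaves = 2 ^ q"

lemma runs_draw_leaf:
  assumes "ival s base = B" "B \<ge> 2" "imem s k = 2 ^ p" "k \<noteq> r_base"
  shows "runs P \<pi> (draw_leaf base (reg k)) s (50 * p + icost base + 40)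
    (\<lambda>s'. imem s' = (imem s)(r_base := B, r_leaves := 2 ^ p,
         r_node := descend B (rmem s) p 1 (rnd s 0 * rmem s (B + 1))) \<and>
       (\<forall>x. x \<noteq> 1 \<longrightarrow> rmem s' x = rmem s x) \<and> rnd s' = (\<lambda>k. rnd s (Suc k)))"
proof -
  let ?c = "set_reg r_base base ;; set_reg r_leaves (reg k) ;; set_reg r_node (IConst 1) ;;
      Draw (IConst 1) ;; set_real_reg (RMul real_reg (RLoad (cell (IConst 1))))"
  define R where "R s' \<longleftrightarrow> imem s' = (imem s)(r_base := B, r_leaves := 2 ^ p, r_node := 1) \<and>
    rmem s' = (rmem s)(1 := rnd s 0 * rmem s (B + 1)) \<and> rnd s' = (\<lambda>k. rnd s (Suc k))"
    for s' :: store
  have init: "runs P \<pi> ?c s (time_bound ?c) R"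
    using assms by (intro runs_loop_free) (auto simp: R_def fun_eq_iff)
  have loop: "runs P \<pi> descend_loop s' (50 * p + 10)
     (\<lambda>s'. imem s' = (imem s)(r_base := B, r_leaves := 2 ^ p,
         r_node := descend B (rmem s) p 1 (rnd s 0 * rmem s (B + 1))) \<and>
       (\<forall>x. x \<noteq> 1 \<longrightarrow> rmem s' x = rmem s x) \<and> rnd s' = (\<lambda>k. rnd s (Suc k)))"
    if "R s'" for s'
  proof (rule runs_mono[OF runs_descend_loop[of s' p]])
    show "imem s' r_node = 1" "imem s' r_leaves = 2 ^ p" "imem s' r_base \<ge> 2"
      using that assms by (auto simp: R_def)
    have "descend B (rmem s') p 1 r = descend B (rmem s) p 1 r" for r
      using that assms(2) by (intro descend_cong) (auto simp: R_def)
    then show "imem s'' = (imem s)(r_base := B, r_leaves := 2 ^ p,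
         r_node := descend B (rmem s) p 1 (rnd s 0 * rmem s (B + 1))) \<and>
       (\<forall>x. x \<noteq> 1 \<longrightarrow> rmem s'' x = rmem s x) \<and> rnd s'' = (\<lambda>k. rnd s (Suc k))"
      if "imem s'' = (imem s')
             (r_node := descend (imem s' r_base) (rmem s') p 1 (rmem s' 1)) \<and>
            (\<forall>x. x \<noteq> 1 \<longrightarrow> rmem s'' x = rmem s' x) \<and> rnd s'' = rnd s'" for s''
      using that \<open>R s'\<close> by (auto simp: R_def)
  qed simp
  show ?thesis
    unfolding draw_leaf_def
    by (rule runs_mono, rule runs_seq, rule init, erule loop) auto
qed

definition drawn_action :: "nat \<Rightarrow> nat \<Rightarrow> nat \<Rightarrow> (nat \<Rightarrow> real) \<Rightarrow> nat \<Rightarrow> real \<Rightarrow> nat" where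
  "drawn_action m p q \<mu> i r =
     descend (slot m p q i 0) \<mu> p 1 (r * \<mu> (slot m p q i 0 + 1)) - 2 ^ p"

definition drawn_state :: "nat \<Rightarrow> nat \<Rightarrow> nat \<Rightarrow> (nat \<Rightarrow> real) \<Rightarrow> nat \<Rightarrow> nat \<Rightarrow> real \<Rightarrow> nat" where
  "drawn_state m p q \<mu> i a r =
     descend (slot m p q i (a + 1)) \<mu> q 1 (r * \<mu> (slot m p q i (a + 1) + 1)) - 2 ^ q"

text \<open>
  The second descent reads the memory as it was before the call, since the first one writes only to
  the real register.
\<close>

lemma runs_sample_prog:
  assumes conf: "configured n m p q s" and "imem s 0 = i"
  shows "runs P \<pi> sample_prog s (50 * p + 50 * q + 200)
    (\<lambda>s'. imem s' 0 = drawn_action m p q (rmem s) i (rnd s 0) \<and>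
       imem s' 1 = drawn_state m p q (rmem s) i (imem s' 0) (rnd s 1) \<and>
       configured n m p q s' \<and> (\<forall>x. x \<noteq> 1 \<longrightarrow> rmem s' x = rmem s x))"
proof -
  let ?a = "drawn_action m p q (rmem s) i (rnd s 0)"
  define R1 where "R1 s' \<longleftrightarrow> configured n m p q s' \<and> imem s' 0 = i \<and> imem s' r_node - 2 ^ p = ?a \<and>
    (\<forall>x. x \<noteq> 1 \<longrightarrow> rmem s' x = rmem s x) \<and> rnd s' 0 = rnd s 1" for s' :: store
  define R2 where "R2 s' \<longleftrightarrow> configured n m p q s' \<and> imem s' 0 = i \<and> imem s' r_a = ?a \<and>
    (\<forall>x. x \<noteq> 1 \<longrightarrow> rmem s' x = rmem s x) \<and> rnd s' 0 = rnd s 1" for s' :: store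
  define R3 where "R3 s' \<longleftrightarrow> configured n m p q s' \<and> imem s' r_a = ?a \<and>
    imem s' r_node - 2 ^ q = drawn_state m p q (rmem s) i ?a (rnd s 1) \<and>
    (\<forall>x. x \<noteq> 1 \<longrightarrow> rmem s' x = rmem s x)" for s' :: store
  let ?e1 = "slot_exp (reg 0) (IConst 0)"
  let ?e2 = "slot_exp (reg 0) (IAdd (reg r_a) (IConst 1))"
  have slot2: "slot m p q i b \<ge> 2" for b
    using slot_ge[of m p q i b] by simp
  have 1: "runs P \<pi> (draw_leaf ?e1 (reg r_action_leaves)) s (50 * p + icost ?e1 + 40) R1"
    using assms slot2
    by (intro runs_mono[OF runs_draw_leaf[where B = "slot m p q i 0" and p = p]])
      (auto simp: configured_def ival_slot_exp R1_def drawn_action_def)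
  let ?c2 = "set_reg r_a (ISub (reg r_node) (reg r_action_leaves))"
  have 2: "runs P \<pi> ?c2 s' (time_bound ?c2) R2" if "R1 s'" for s'
    using that by (intro runs_loop_free) (auto simp: R1_def R2_def configured_def)
  have 3: "runs P \<pi> (draw_leaf ?e2 (reg r_state_leaves)) s' (50 * q + icost ?e2 + 40) R3"
    if R2: "R2 s'" for s'
  proof (rule runs_mono[OF runs_draw_leaf[where B = "slot m p q i (?a + 1)" and p = q]])
    let ?B = "slot m p q i (?a + 1)"
    show "ival s' ?e2 = ?B" "?B \<ge> 2" "imem s' r_state_leaves = 2 ^ q"
      using R2 slot2 by (auto simp: R2_def configured_def ival_slot_exp)
    have same: "rmem s' x = rmem s x" if "x \<ge> ?B" for x
      using R2 that slot2[of "?a + 1"] by (auto simp: R2_def)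
    then have "descend ?B (rmem s') h v r = descend ?B (rmem s) h v r" for h v r
      by (rule descend_cong)
    then show "R3 s''" if "imem s'' = (imem s')(r_base := ?B, r_leaves := 2 ^ q,
            r_node := descend ?B (rmem s') q 1 (rnd s' 0 * rmem s' (?B + 1))) \<and>
        (\<forall>x. x \<noteq> 1 \<longrightarrow> rmem s'' x = rmem s' x) \<and> rnd s'' = (\<lambda>k. rnd s' (Suc k))" for s''
      using R2 that same[of "?B + 1"]
      by (auto simp: R2_def R3_def configured_def drawn_state_def)
  qed auto
  let ?c4 = "set_reg 0 (reg r_a) ;; set_reg 1 (ISub (reg r_node) (reg r_state_leaves))"
  have 4: "runs P \<pi> ?c4 s' (time_bound ?c4)
     (\<lambda>s'. imem s' 0 = ?a \<and>
       imem s' 1 = drawn_state m p q (rmem s) i (imem s' 0) (rnd s 1) \<and>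
       configured n m p q s' \<and> (\<forall>x. x \<noteq> 1 \<longrightarrow> rmem s' x = rmem s x))" if "R3 s'" for s'
    using that by (intro runs_loop_free) (auto simp: R3_def configured_def)
  show ?thesis
    unfolding sample_prog_def
    by (rule runs_mono, rule runs_seq, rule 1, rule runs_seq, erule 2, rule runs_seq, erule 3, erule 4)
      (auto simp: icost_slot_exp)
qed

lemma runs_update_prog:
  assumes conf: "configured n m p q s" and "imem s 0 = i" "imem s 1 = a" "a < 2 ^ p"
  defines "B \<equiv> slot m p q i 0"
  defines "d \<equiv> rmem s 0 * rmem s (B + 1) - rmem s (B + (2 ^ p + a))"
  shows "runs P \<pi> update_prog s (26 * p + 100)
    (\<lambda>s'. configured n m p q s' \<and> rmem s' = add_path B d (2 ^ p + a) ((rmem s)(1 := d)))"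
proof -
  let ?c = "set_reg r_base (slot_exp (reg 0) (IConst 0)) ;;
      set_reg r_node (IAdd (reg r_action_leaves) (reg 1)) ;;
      set_real_reg (RSub (RMul (RLoad (IConst 0)) (RLoad (cell (IConst 1))))
        (RLoad (cell (reg r_node))))"
  define R where "R s' \<longleftrightarrow> configured n m p q s' \<and> imem s' r_base = B \<and> imem s' r_node = 2 ^ p + a \<and>
    rmem s' = (rmem s)(1 := d)" for s' :: store
  have 1: "runs P \<pi> ?c s (time_bound ?c) R"
    using assms(1-3)
    by (intro runs_loop_free) (auto simp: R_def configured_def ival_slot_exp B_def d_def)
  have 2: "runs P \<pi> add_to_leaf s' (26 * Suc p + 5)
    (\<lambda>s'. configured n m p q s' \<and> rmem s' = add_path B d (2 ^ p + a) ((rmem s)(1 := d)))"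
    if "R s'" for s'
    using that assms(4) slot_ge[of m p q i 0]
    by (intro runs_mono[OF runs_add_to_leaf[of s' "Suc p"]]) (auto simp: R_def configured_def B_def)
  show ?thesis
    unfolding update_prog_def
    by (rule runs_mono, rule runs_seq, rule 1, erule 2) (auto simp: icost_slot_exp)
qed

text \<open>
  The exponent is given in advance, instead of being asserted to exist afterwards, because the time
  bounds of the subsequent commands depend on it.
\<close>

lemma runs_round_up:
  assumes "imem s src = m" "src \<noteq> t" "m < 2 ^ p" "2 ^ p \<le> 2 * m"
  shows "runs P \<pi> (round_up t src) s (20 * p + 20)
    (\<lambda>s'. imem s' = (imem s)(t := 2 ^ p) \<and> rmem s' = rmem s)"
proof -
  define I where "I k s' \<longleftrightarrow> k \<le> p \<and> imem s' = (imem s)(t := 2 ^ (p - k)) \<and> rmem s' = rmem s"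
    for k and s' :: store
  let ?i = "set_reg t (IConst 1)"
  let ?b = "ILess (reg t) (IAdd (reg src) (IConst 1))"
  let ?c = "set_reg t (IMul (IConst 2) (reg t))"
  have 1: "runs P \<pi> ?i s (time_bound ?i) (I p)"
    by (intro runs_loop_free) (auto simp: I_def)
  have 2: "runs P \<pi> (While ?b ?c) s' (p * (1 + bcost ?b + time_bound ?c) + 1 + bcost ?b)
    (\<lambda>s'. imem s' = (imem s)(t := 2 ^ p) \<and> rmem s' = rmem s)" if "I p s'" for s'
  proof (rule runs_while[where I = I])
    fix k s'
    assume I: "I k s'" and "bval P \<pi> s' ?b"
    then have "2 ^ (p - k) \<le> m"
      using assms(1,2) by (simp add: I_def)
    with assms(3) have "k > 0"
      by (cases k) auto
    then have "Suc (p - k) = p - (k - 1)"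
      using I unfolding I_def by linarith
    then have "2 * 2 ^ (p - k) = (2::nat) ^ (p - (k - 1))"
      by (metis power_Suc)
    then have "I (k - 1) (effect P \<pi> ?c s')"
      using I by (auto simp: I_def)
    with \<open>k > 0\<close> show "k > 0 \<and> runs P \<pi> ?c s' (time_bound ?c) (I (k - 1))"
      by (auto intro!: runs_loop_free simp del: effect.simps time_bound.simps)
  next
    fix k s'
    assume I: "I k s'" and exit: "\<not> bval P \<pi> s' ?b"
    have "k = 0"
    proof (rule ccontr)
      assume "k \<noteq> 0"
      then have "(2::nat) ^ Suc (p - k) \<le> 2 ^ p"
        using I by (intro power_increasing) (auto simp: I_def)
      with I exit assms show False by (auto simp: I_def)
    qed
    with I show "imem s' = (imem s)(t := 2 ^ p) \<and> rmem s' = rmem s"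
      by (simp add: I_def)
  qed (rule that)
  show ?thesis
    unfolding round_up_def
    by (rule runs_mono, rule runs_seq, rule 1, erule 2) auto
qed

text \<open>
  The input restricted to the entries that precede a given position in the loading order, and zero
  elsewhere: these are the weights in the forest when the loops of the preprocessing have reached
  that position.
\<close>

definition policy_before ::
  "nat \<Rightarrow> (nat \<Rightarrow> nat \<Rightarrow> real) \<Rightarrow> nat \<Rightarrow> nat \<Rightarrow> (nat \<Rightarrow> nat \<Rightarrow> real)" where
  "policy_before m \<pi> i a =
     (\<lambda>i' a'. if a' < m \<and> (i' < i \<or> i' = i \<and> a' < a) then \<pi> i' a' else 0)"

definition kernel_before ::
  "nat \<Rightarrow> nat \<Rightarrow> (nat \<Rightarrow> nat \<Rightarrow> nat \<Rightarrow> real) \<Rightarrow> nat \<Rightarrow> nat \<Rightarrow> nat \<Rightarrow> (nat \<Rightarrow> nat \<Rightarrow> nat \<Rightarrow> real)" where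
  "kernel_before n m P i a j =
     (\<lambda>i' a' j'. if a' < m \<and> j' < n \<and> (i' < i \<or> i' = i \<and> (a' < a \<or> a' = a \<and> j' < j))
        then P a' i' j' else 0)"

lemma policy_before_Suc:
  "a < m \<Longrightarrow> policy_before m \<pi> i (Suc a) =
    (policy_before m \<pi> i a)(i := (policy_before m \<pi> i a i)(a := policy_before m \<pi> i a i a + \<pi> i a))"
  by (auto simp: policy_before_def fun_eq_iff)

lemma policy_before_row: "policy_before m \<pi> i m = policy_before m \<pi> (Suc i) 0"
  by (auto simp: policy_before_def fun_eq_iff less_Suc_eq)

lemma kernel_before_Suc:
  "a < m \<Longrightarrow> j < n \<Longrightarrow> kernel_before n m P i a (Suc j) =
    (kernel_before n m P i a j)(i := (kernel_before n m P i a j i)(a :=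
       (kernel_before n m P i a j i a)(j := kernel_before n m P i a j i a j + P a i j)))"
  by (auto simp: kernel_before_def fun_eq_iff)

lemma kernel_before_row: "kernel_before n m P i a n = kernel_before n m P i (Suc a) 0"
  by (auto simp: kernel_before_def fun_eq_iff less_Suc_eq)

lemma kernel_before_state: "kernel_before n m P i m 0 = kernel_before n m P (Suc i) 0 0"
  by (auto simp: kernel_before_def fun_eq_iff less_Suc_eq)

text \<open>
  The state of the forest while the entries of state \<open>i\<close> and action \<open>a\<close> are loaded.  Within one
  round the policy entry is inserted first, so the policy trees are complete before \<open>a'\<close>, which is
  \<open>a\<close> or \<open>Suc a\<close>, and the others before \<open>j\<close>.
\<close>

definition loading ::
  "nat \<Rightarrow> nat \<Rightarrow> nat \<Rightarrow> nat \<Rightarrow> (nat \<Rightarrow> nat \<Rightarrow> nat \<Rightarrow> real) \<Rightarrow> (nat \<Rightarrow> nat \<Rightarrow> real) \<Rightarrow>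
   nat \<Rightarrow> nat \<Rightarrow> nat \<Rightarrow> nat \<Rightarrow> store \<Rightarrow> bool" where
  "loading n m p q P \<pi> i a a' j s \<longleftrightarrow>
     configured n m p q s \<and> imem s r_i = i \<and> imem s r_a = a \<and>
     forest n m p q (policy_before m \<pi> i a') (kernel_before n m P i a j) (rmem s)"

lemma runs_load_kernel_row:
  assumes "loading n m p q P \<pi> i a (Suc a) 0 s" "imem s r_base = slot m p q i (a + 1)"
    and "imem s r_j = 0" "i < n" "a < m" "n < 2 ^ q"
  shows "runs P \<pi> load_kernel_row s (n * (26 * q + 100) + 10)
    (loading n m p q P \<pi> i a (Suc a) n)"
proof -
  define I where "I k s' \<longleftrightarrow> (\<exists>j. imem s' r_j = j \<and> j + k = n \<and>
    imem s' r_base = slot m p q i (a + 1) \<and> loading n m p q P \<pi> i a (Suc a) j s')"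
    for k and s' :: store
  let ?b = "ILess (reg r_j) (reg r_states)"
  let ?c1 = "set_reg r_node (IAdd (reg r_state_leaves) (reg r_j)) ;;
         set_real_reg (QueryP (reg r_a) (reg r_i) (reg r_j))"
  let ?c3 = "set_reg r_j (IAdd (reg r_j) (IConst 1))"
  let ?T = "26 * q + 80"
  have body: "runs P \<pi> (?c1 ;; add_to_leaf ;; ?c3) s' ?T (I k)" if I: "I (Suc k) s'" for k s'
  proof -
    from I obtain j where j: "imem s' r_j = j" "j < n" "j + Suc k = n"
      and base: "imem s' r_base = slot m p q i (a + 1)"
      and load: "loading n m p q P \<pi> i a (Suc a) j s'"
      unfolding I_def by auto
    define R1 where "R1 s1 \<longleftrightarrow> loading n m p q P \<pi> i a (Suc a) j s1 \<and> imem s1 r_j = j \<and>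
      imem s1 r_base = slot m p q i (a + 1) \<and> imem s1 r_node = 2 ^ q + j \<and> rmem s1 1 = P a i j"
      for s1 :: store
    define R2 where "R2 s2 \<longleftrightarrow> loading n m p q P \<pi> i a (Suc a) (Suc j) s2 \<and> imem s2 r_j = j \<and>
      imem s2 r_base = slot m p q i (a + 1)" for s2 :: store
    have forest1: "forest n m p q w K ((rmem s')(1 := d)) \<longleftrightarrow> forest n m p q w K (rmem s')" for w K d
      by (rule forest_cong) simp
    have 1: "runs P \<pi> ?c1 s' (time_bound ?c1) R1"
      using load j base
      by (intro runs_loop_free) (auto simp: R1_def loading_def configured_def forest1[simplified])
    have 2: "runs P \<pi> add_to_leaf s1 (26 * Suc q + 5) R2" if R1: "R1 s1" for s1
    proof (rule runs_mono[OF runs_add_to_leaf[of s1 "Suc q"]])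
      show "imem s1 r_node < 2 ^ Suc q" "imem s1 r_base \<ge> 1"
        using R1 j assms(6) slot_ge[of m p q i "a + 1"] by (auto simp: R1_def)
      show "R2 s2" if "imem s2 = (imem s1)(r_node := 0) \<and>
           rmem s2 = add_path (imem s1 r_base) (rmem s1 1) (imem s1 r_node) (rmem s1)" for s2
        using that R1 forest_add_kernel[of n m p q _ "kernel_before n m P i a j" "rmem s1" i a j "P a i j"]
          assms(4-6) j
        by (auto simp: R1_def R2_def loading_def configured_def kernel_before_Suc)
    qed simp
    have 3: "runs P \<pi> ?c3 s2 (time_bound ?c3) (I k)" if "R2 s2" for s2
      using that j by (intro runs_loop_free) (auto simp: R2_def I_def loading_def configured_def)
    show ?thesis
      by (rule runs_mono, rule runs_seq, rule 1, rule runs_seq, erule 2, erule 3) auto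
  qed
  have "runs P \<pi> (While ?b (?c1 ;; add_to_leaf ;; ?c3)) s (n * (1 + bcost ?b + ?T) + 1 + bcost ?b)
    (loading n m p q P \<pi> i a (Suc a) n)"
  proof (rule runs_while[where I = I])
    fix k s'
    assume I: "I k s'" and "bval P \<pi> s' ?b"
    then have "k > 0"
      by (auto simp: I_def loading_def configured_def)
    with body[of "k - 1" s'] I show "k > 0 \<and> runs P \<pi> (?c1 ;; add_to_leaf ;; ?c3) s' ?T (I (k - 1))"
      by simp
  next
    fix k s'
    assume "I k s'" and "\<not> bval P \<pi> s' ?b"
    then show "loading n m p q P \<pi> i a (Suc a) n s'"
      by (auto simp: I_def loading_def configured_def)
  next
    show "I n s"
      using assms(1-3) by (simp add: I_def)
  qed
  then show ?thesis
    unfolding load_kernel_row_def by (rule runs_mono) (auto simp: algebra_simps)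
qed

lemma runs_load_actions:
  assumes "loading n m p q P \<pi> i 0 0 0 s" "i < n" "m < 2 ^ p" "n < 2 ^ q"
  shows "runs P \<pi> load_actions s (m * (26 * p + n * (26 * q + 100) + 200) + 10)
    (loading n m p q P \<pi> i m m 0)"
proof -
  define I where "I k s' \<longleftrightarrow> (\<exists>a. a + k = m \<and> loading n m p q P \<pi> i a a 0 s')"
    for k and s' :: store
  let ?b = "ILess (reg r_a) (reg r_actions)"
  let ?c1 = "set_reg r_base (slot_exp (reg r_i) (IConst 0)) ;;
         set_reg r_node (IAdd (reg r_action_leaves) (reg r_a)) ;;
         set_real_reg (QueryPol (reg r_i) (reg r_a))"
  let ?c3 = "set_reg r_base (slot_exp (reg r_i) (IAdd (reg r_a) (IConst 1))) ;;
         set_reg r_j (IConst 0)"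
  let ?c5 = "set_reg r_a (IAdd (reg r_a) (IConst 1))"
  let ?c = "?c1 ;; add_to_leaf ;; ?c3 ;; load_kernel_row ;; ?c5"
  let ?T = "26 * p + n * (26 * q + 100) + 150"
  have body: "runs P \<pi> ?c s' ?T (I k)" if I: "I (Suc k) s'" for k s'
  proof -
    from I obtain a where a: "a < m" "a + Suc k = m"
      and load: "loading n m p q P \<pi> i a a 0 s'"
      unfolding I_def by auto
    define R1 where "R1 s1 \<longleftrightarrow> loading n m p q P \<pi> i a a 0 s1 \<and>
      imem s1 r_base = slot m p q i 0 \<and> imem s1 r_node = 2 ^ p + a \<and> rmem s1 1 = \<pi> i a"
      for s1 :: store
    define R3 where "R3 s3 \<longleftrightarrow> loading n m p q P \<pi> i a (Suc a) 0 s3 \<and> imem s3 r_j = 0 \<and>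
      imem s3 r_base = slot m p q i (a + 1)" for s3 :: store
    have forest1: "forest n m p q w K ((rmem s')(1 := d)) \<longleftrightarrow> forest n m p q w K (rmem s')" for w K d
      by (rule forest_cong) simp
    have 1: "runs P \<pi> ?c1 s' (time_bound ?c1) R1"
      using load
      by (intro runs_loop_free)
        (auto simp: R1_def loading_def configured_def ival_slot_exp forest1[simplified])
    have 2: "runs P \<pi> add_to_leaf s1 (26 * Suc p + 5) (loading n m p q P \<pi> i a (Suc a) 0)"
      if R1: "R1 s1" for s1
    proof (rule runs_mono[OF runs_add_to_leaf[of s1 "Suc p"]])
      show "imem s1 r_node < 2 ^ Suc p" "imem s1 r_base \<ge> 1"
        using R1 a assms(3) slot_ge[of m p q i 0] by (auto simp: R1_def)
      show "loading n m p q P \<pi> i a (Suc a) 0 s2" if "imem s2 = (imem s1)(r_node := 0) \<and>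
           rmem s2 = add_path (imem s1 r_base) (rmem s1 1) (imem s1 r_node) (rmem s1)" for s2
        using that R1 forest_add_policy[of n m p q "policy_before m \<pi> i a" _ "rmem s1" i a "\<pi> i a"]
          assms(2,3) a
        by (auto simp: R1_def loading_def configured_def policy_before_Suc)
    qed simp
    have 3: "runs P \<pi> ?c3 s2 (time_bound ?c3) R3" if "loading n m p q P \<pi> i a (Suc a) 0 s2" for s2
      using that
      by (intro runs_loop_free) (auto simp: R3_def loading_def configured_def ival_slot_exp)
    have 4: "runs P \<pi> load_kernel_row s3 (n * (26 * q + 100) + 10)
        (loading n m p q P \<pi> i a (Suc a) n)" if "R3 s3" for s3
      using that a assms by (intro runs_load_kernel_row) (auto simp: R3_def)
    have 5: "runs P \<pi> ?c5 s4 (time_bound ?c5) (I k)" if "loading n m p q P \<pi> i a (Suc a) n s4" for s4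
    proof (rule runs_loop_free)
      have "loading n m p q P \<pi> i (Suc a) (Suc a) 0 (effect P \<pi> ?c5 s4)"
        using that by (simp add: loading_def configured_def kernel_before_row)
      then show "I k (effect P \<pi> ?c5 s4)"
        unfolding I_def using a(2) by (intro exI[of _ "Suc a"]) simp
    qed simp
    show ?thesis
      by (rule runs_mono, rule runs_seq, rule 1, rule runs_seq, erule 2, rule runs_seq, erule 3,
          rule runs_seq, erule 4, erule 5) (auto simp: icost_slot_exp)
  qed
  have "runs P \<pi> (While ?b ?c) s (m * (1 + bcost ?b + ?T) + 1 + bcost ?b)
    (loading n m p q P \<pi> i m m 0)"
  proof (rule runs_while[where I = I])
    fix k s'
    assume I: "I k s'" and "bval P \<pi> s' ?b"
    then have "k > 0"
      by (auto simp: I_def loading_def configured_def)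
    with body[of "k - 1" s'] I show "k > 0 \<and> runs P \<pi> ?c s' ?T (I (k - 1))"
      by simp
  next
    fix k s'
    assume "I k s'" and exit: "\<not> bval P \<pi> s' ?b"
    then obtain a where a: "a + k = m" "loading n m p q P \<pi> i a a 0 s'"
      unfolding I_def by blast
    with exit have "a = m"
      by (simp add: loading_def configured_def)
    with a show "loading n m p q P \<pi> i m m 0 s'" by simp
  next
    show "I m s"
      using assms(1) by (simp add: I_def)
  qed
  then show ?thesis
    unfolding load_actions_def by (rule runs_mono) (auto simp: algebra_simps)
qed

lemma runs_load_states:
  assumes "configured n m p q s" "imem s r_i = 0"
    and "forest n m p q (\<lambda>_ _. 0) (\<lambda>_ _ _. 0) (rmem s)" "m < 2 ^ p" "n < 2 ^ q"
  shows "runs P \<pi> load_states s (n * (m * (26 * p + n * (26 * q + 100) + 200) + 40) + 10)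
    (\<lambda>s'. configured n m p q s' \<and>
       forest n m p q (policy_before m \<pi> n 0) (kernel_before n m P n 0 0) (rmem s'))"
proof -
  define R where "R i s' \<longleftrightarrow> configured n m p q s' \<and> imem s' r_i = i \<and>
     forest n m p q (policy_before m \<pi> i 0) (kernel_before n m P i 0 0) (rmem s')"
    for i and s' :: store
  define I where "I k s' \<longleftrightarrow> (\<exists>i. i + k = n \<and> R i s')" for k and s' :: store
  let ?b = "ILess (reg r_i) (reg r_states)"
  let ?c1 = "set_reg r_a (IConst 0)"
  let ?c3 = "set_reg r_i (IAdd (reg r_i) (IConst 1))"
  let ?c = "?c1 ;; load_actions ;; ?c3"
  let ?T = "m * (26 * p + n * (26 * q + 100) + 200) + 30"
  have body: "runs P \<pi> ?c s' ?T (I k)" if I: "I (Suc k) s'" for k s'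
  proof -
    from I obtain i where i: "i < n" "i + Suc k = n" and R: "R i s'"
      unfolding I_def by auto
    have 1: "runs P \<pi> ?c1 s' (time_bound ?c1) (loading n m p q P \<pi> i 0 0 0)"
      using R by (intro runs_loop_free) (auto simp: R_def loading_def configured_def)
    have 2: "runs P \<pi> load_actions s1 (m * (26 * p + n * (26 * q + 100) + 200) + 10)
      (loading n m p q P \<pi> i m m 0)" if "loading n m p q P \<pi> i 0 0 0 s1" for s1
      using that i assms by (intro runs_load_actions)
    have 3: "runs P \<pi> ?c3 s2 (time_bound ?c3) (I k)" if "loading n m p q P \<pi> i m m 0 s2" for s2
    proof (rule runs_loop_free)
      have "R (Suc i) (effect P \<pi> ?c3 s2)"
        using that
        by (simp add: R_def loading_def configured_def kernel_before_state policy_before_row)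
      then show "I k (effect P \<pi> ?c3 s2)"
        unfolding I_def using i(2) by (intro exI[of _ "Suc i"]) simp
    qed simp
    show ?thesis
      by (rule runs_mono, rule runs_seq, rule 1, rule runs_seq, erule 2, erule 3) auto
  qed
  have "runs P \<pi> (While ?b ?c) s (n * (1 + bcost ?b + ?T) + 1 + bcost ?b) (R n)"
  proof (rule runs_while[where I = I])
    fix k s'
    assume I: "I k s'" and "bval P \<pi> s' ?b"
    then have "k > 0"
      by (auto simp: I_def R_def configured_def)
    with body[of "k - 1" s'] I show "k > 0 \<and> runs P \<pi> ?c s' ?T (I (k - 1))"
      by simp
  next
    fix k s'
    assume "I k s'" and exit: "\<not> bval P \<pi> s' ?b"
    then obtain i where i: "i + k = n" "R i s'"
      unfolding I_def by blast
    with exit have "i = n"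
      by (simp add: R_def configured_def)
    with i show "R n s'" by simp
  next
    show "I n s"
      using assms by (simp add: I_def R_def policy_before_def kernel_before_def)
  qed
  then show ?thesis
    unfolding load_states_def by (rule runs_mono) (auto simp: algebra_simps R_def)
qed

text \<open>
  The initial memory is already a valid forest, so inserting entries one by one needs no separate
  construction of the trees.
\<close>

lemma forest_empty: "(\<And>x. x \<ge> 2 \<Longrightarrow> \<mu> x = 0) \<Longrightarrow> forest n m p q (\<lambda>_ _. 0) (\<lambda>_ _ _. 0) \<mu>"
  by (subst forest_cong[where \<mu> = "\<lambda>_. 0"]) (auto simp: forest_def sum_tree_def)

lemma runs_preprocess_prog:
  assumes "m < 2 ^ p" "2 ^ p \<le> 2 * m" "n < 2 ^ q" "2 ^ q \<le> 2 * n"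
  shows "runs P \<pi> preprocess_prog (prep_call n m u)
    (n * (m * (26 * p + n * (26 * q + 100) + 200) + 40) + 20 * p + 20 * q + 100)
    (\<lambda>s'. configured n m p q s' \<and>
       forest n m p q (policy_before m \<pi> n 0) (kernel_before n m P n 0 0) (rmem s'))"
proof -
  let ?c1 = "set_reg r_states (reg 0) ;; set_reg r_actions (reg 1)"
  let ?c4 = "set_reg r_i (IConst 0)"
  define R1 where "R1 s \<longleftrightarrow> imem s r_states = n \<and> imem s r_actions = m \<and> (\<forall>x. rmem s x = 0)"
    for s :: store
  define R2 where "R2 s \<longleftrightarrow> R1 s \<and> imem s r_action_leaves = 2 ^ p" for s :: store
  define R3 where "R3 s \<longleftrightarrow> R2 s \<and> imem s r_state_leaves = 2 ^ q" for s :: store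
  define R4 where "R4 s \<longleftrightarrow> R3 s \<and> imem s r_i = 0" for s :: store
  have 1: "runs P \<pi> ?c1 (prep_call n m u) (time_bound ?c1) R1"
    by (intro runs_loop_free) (auto simp: R1_def prep_call_def call_def)
  have 2: "runs P \<pi> (round_up r_action_leaves r_actions) s (20 * p + 20) R2" if "R1 s" for s
    using that assms
    by (intro runs_mono[OF runs_round_up[where m = m and p = p]]) (auto simp: R1_def R2_def)
  have 3: "runs P \<pi> (round_up r_state_leaves r_states) s (20 * q + 20) R3" if "R2 s" for s
    using that assms
    by (intro runs_mono[OF runs_round_up[where m = n and p = q]]) (auto simp: R1_def R2_def R3_def)
  have 4: "runs P \<pi> ?c4 s (time_bound ?c4) R4" if "R3 s" for s
    using that by (intro runs_loop_free) (auto simp: R1_def R2_def R3_def R4_def)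
  have 5: "runs P \<pi> load_states s (n * (m * (26 * p + n * (26 * q + 100) + 200) + 40) + 10)
    (\<lambda>s'. configured n m p q s' \<and>
       forest n m p q (policy_before m \<pi> n 0) (kernel_before n m P n 0 0) (rmem s'))" if "R4 s" for s
    using that assms
    by (intro runs_load_states forest_empty)
      (auto simp: R1_def R2_def R3_def R4_def configured_def)
  show ?thesis
    unfolding preprocess_prog_def
    by (rule runs_mono, rule runs_seq, rule 1, rule runs_seq, erule 2, rule runs_seq, erule 3,
          rule runs_seq, erule 4, erule 5) auto
qed


section \<open>The policy represented by the memory\<close>

text \<open>
  The invariant between calls.  The existentially quantified \<open>c\<close> absorbs all normalizing factors.
\<close>

definition represents ::
  "nat \<Rightarrow> nat \<Rightarrow> nat \<Rightarrow> nat \<Rightarrow> (nat \<Rightarrow> nat \<Rightarrow> nat \<Rightarrow> real) \<Rightarrow> (nat \<Rightarrow> nat \<Rightarrow> real) \<Rightarrow> store \<Rightarrow> bool" where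
  "represents n m p q P \<pi> s \<longleftrightarrow> configured n m p q s \<and> is_policy n m \<pi> \<and>
     (\<exists>c. (\<forall>i<n. c i > 0) \<and>
       forest n m p q (\<lambda>i a. if a < m then c i * \<pi> i a else 0)
         (\<lambda>i a j. if j < n then P a i j else 0) (rmem s))"

lemma represents_preprocess:
  assumes "is_policy n m \<pi>" "m < 2 ^ p" "2 ^ p \<le> 2 * m" "n < 2 ^ q" "2 ^ q \<le> 2 * n"
    and "exec P \<pi> preprocess_prog (prep_call n m u) t s"
  shows "represents n m p q P \<pi> s"
proof -
  have s: "configured n m p q s"
    "forest n m p q (policy_before m \<pi> n 0) (kernel_before n m P n 0 0) (rmem s)"
    using runs_exec[OF runs_preprocess_prog[OF assms(2-5)] assms(6)] by auto
  have "policy_before m \<pi> n 0 i = (\<lambda>a. if a < m then 1 * \<pi> i a else 0)" if "i < n" for i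
    using that by (auto simp: policy_before_def)
  moreover have "kernel_before n m P n 0 0 i a = (\<lambda>j. if j < n then P a i j else 0)"
    if "i < n" "a < m" for i a
    using that by (auto simp: kernel_before_def)
  ultimately have "forest n m p q (\<lambda>i a. if a < m then 1 * \<pi> i a else 0)
      (\<lambda>i a j. if j < n then P a i j else 0) (rmem s)"
    using s(2) unfolding forest_def by auto
  with s(1) assms(1) show ?thesis
    unfolding represents_def by (intro conjI exI[of _ "\<lambda>_. 1"]) auto
qed

lemma represents_sample:
  assumes "represents n m p q P \<pi> s" "exec P \<pi>\<^sub>0 sample_prog (sample_call s i u) t s'"
  shows "represents n m p q P \<pi> s'"
proof -
  let ?s = "sample_call s i u"
  have "configured n m p q ?s" "imem ?s 0 = i"
    using assms(1) by (auto simp: sample_call_def call_def represents_def configured_def)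
  from runs_exec[OF runs_sample_prog[OF this] assms(2)]
  have s': "configured n m p q s'" "\<And>x. x \<noteq> 1 \<Longrightarrow> rmem s' x = rmem ?s x" by auto
  then have "rmem s' x = rmem s x" if "x \<ge> 2" for x
    using that by (simp add: sample_call_def call_def)
  then have "forest n m p q w K (rmem s') \<longleftrightarrow> forest n m p q w K (rmem s)" for w K
    by (rule forest_cong)
  with assms(1) s'(1) show ?thesis
    unfolding represents_def by simp
qed

lemma is_policy_update_policy:
  assumes "is_policy n m \<pi>" "valid_update n m \<pi> i a x"
  shows "is_policy n m (update_policy m \<pi> i a x)"
proof -
  let ?v = "(\<pi> i)(a := x)"
  have v: "?v b \<ge> 0" if "b < m" for b
    using assms that by (auto simp: is_policy_def valid_update_def)
  then have "norm1 m ?v = (\<Sum>b<m. ?v b)"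
    unfolding norm1_def by (intro sum.cong) auto
  moreover have "norm1 m ?v > 0"
    using assms(2) by (simp add: valid_update_def)
  ultimately have "(\<Sum>b<m. ?v b / norm1 m ?v) = 1" "\<forall>b<m. ?v b / norm1 m ?v \<ge> 0"
    using v by (auto simp flip: sum_divide_distrib)
  then show ?thesis
    using assms(1) unfolding is_policy_def update_policy_def Let_def by simp
qed

text \<open>
  Dividing the new row by its norm \<open>N\<close> and multiplying \<open>c i\<close> by \<open>N\<close> leave the products
  \<open>c i * \<pi> i b\<close> of the other actions unchanged, so a single leaf has to be rewritten.
\<close>

lemma represents_update:
  assumes rep: "represents n m p q P \<pi> s" and valid: "valid_update n m \<pi> i a x" and "m < 2 ^ p"
    and exec: "exec P \<pi>\<^sub>0 update_prog (update_call s i a x u) t s'"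
  shows "represents n m p q P (update_policy m \<pi> i a x) s'"
proof -
  let ?s = "update_call s i a x u" and ?B = "slot m p q i 0"
  define N where "N = norm1 m ((\<pi> i)(a := x))"
  have ia: "i < n" "a < m" "a < 2 ^ p" "N > 0"
    using valid \<open>m < 2 ^ p\<close> by (auto simp: valid_update_def N_def)
  obtain c where c: "\<And>i. i < n \<Longrightarrow> c i > 0" and
    forest: "forest n m p q (\<lambda>i a. if a < m then c i * \<pi> i a else 0)
         (\<lambda>i a j. if j < n then P a i j else 0) (rmem s)" (is "forest n m p q ?w ?K _")
    using rep unfolding represents_def by blast
  define d where "d = rmem ?s 0 * rmem ?s (?B + 1) - rmem ?s (?B + (2 ^ p + a))"
  have "configured n m p q ?s" "imem ?s 0 = i" "imem ?s 1 = a"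
    using rep by (auto simp: update_call_def call_def represents_def configured_def)
  from runs_exec[OF runs_update_prog[OF this ia(3)] exec, folded d_def]
  have s': "configured n m p q s'" "rmem s' = add_path ?B d (2 ^ p + a) ((rmem ?s)(1 := d))"
    by auto
  have tree: "sum_tree p ?B (?w i) (rmem s)"
    using forest \<open>i < n\<close> unfolding forest_def by blast
  have "rmem s (?B + 1) = (\<Sum>l<2 ^ p. ?w i l)"
    by (rule sum_tree_root[OF tree])
  also have "\<dots> = (\<Sum>l<m. ?w i l)"
    using assms by (intro sum.mono_neutral_right) auto
  also have "\<dots> = c i * (\<Sum>l<m. \<pi> i l)"
    by (simp add: sum_distrib_left)
  also have "\<dots> = c i"
    using rep \<open>i < n\<close> by (simp add: represents_def is_policy_def)
  finally have "d = x * c i - c i * \<pi> i a"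
    using tree ia slot_ge[of m p q i 0]
    by (simp add: d_def update_call_def call_def sum_tree_def)
  moreover have "forest n m p q ?w ?K ((rmem ?s)(1 := d))"
    using forest by (subst forest_cong[where \<mu> = "rmem s"]) (auto simp: update_call_def call_def)
  ultimately have "forest n m p q (?w(i := (?w i)(a := c i * x))) ?K (rmem s')"
    unfolding s'(2) using forest_add_policy[of n m p q ?w ?K "(rmem ?s)(1 := d)" i a d] ia
    by (simp add: mult.commute)
  moreover have "?w(i := (?w i)(a := c i * x)) =
      (\<lambda>i' a'. if a' < m then (c(i := c i * N)) i' * update_policy m \<pi> i a x i' a' else 0)"
    using ia by (auto simp: fun_eq_iff update_policy_def Let_def N_def)
  ultimately show ?thesis
    using s'(1) is_policy_update_policy[OF _ valid] rep c ia unfolding represents_def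
    by (intro conjI exI[of _ "c(i := c i * N)"]) auto
qed

lemma reachable_represents:
  assumes "reachable preprocess_prog update_prog sample_prog n m P \<pi>\<^sub>0 \<pi> s"
    and "is_policy n m \<pi>\<^sub>0" "m < 2 ^ p" "2 ^ p \<le> 2 * m" "n < 2 ^ q" "2 ^ q \<le> 2 * n"
  shows "represents n m p q P \<pi> s"
  using assms(1)
proof induction
  case prep
  with assms show ?case by (intro represents_preprocess)
next
  case (update \<pi> s i a x)
  then show ?case using represents_update[OF update.IH update.hyps(2) assms(3)] by blast
next
  case (sample \<pi> s i)
  then show ?case using represents_sample[OF sample.IH] by blast
qed


section \<open>The law of the generated transition\<close>

lemma prob_space_uniform01: "prob_space (restrict_space lborel {0..1::real})"
  by (rule prob_spaceI) (simp add: emeasure_restrict_space space_restrict_space)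

text \<open>
  The event that the first two random numbers lie in given intervals is a cylinder of the product
  measure.
\<close>

lemma measure_uniforms_first_two:
  assumes "0 \<le> x" "x \<le> y" "y \<le> 1" "0 \<le> x'" "x' \<le> y'" "y' \<le> 1"
  defines "E \<equiv> {u \<in> space uniforms. u 0 \<in> {x..<y} \<and> u 1 \<in> {x'..<y'}}"
  shows "E \<in> sets uniforms" "measure uniforms E = (y - x) * (y' - x')"
proof -
  let ?M = "\<lambda>_::nat. restrict_space lborel {0..1::real}"
  let ?X = "\<lambda>k::nat. if k = 0 then {x..<y} else {x'..<y'}"
  interpret product_prob_space ?M UNIV
    using prob_space_uniform01
    by (simp add: product_prob_space_def product_prob_space_axioms_def product_sigma_finite_def
        prob_space_imp_sigma_finite)
  have X: "?X k \<in> sets (?M k)" for k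
    using assms by (auto simp: sets_restrict_space_iff)
  have interval: "emeasure (restrict_space lborel {0..1}) {c..<d} = ennreal (d - c)"
    if "0 \<le> c" "c \<le> d" "d \<le> 1" for c d :: real
    using that by (subst emeasure_restrict_space) auto
  have E: "E = {u \<in> space (PiM UNIV ?M). \<forall>k\<in>{0, 1}. u k \<in> ?X k}"
    by (auto simp: E_def uniforms_def)
  have "{u \<in> space (PiM UNIV ?M). \<forall>k\<in>{0, 1}. u k \<in> ?X k} \<in> sets (PiM UNIV ?M)"
    using X by measurable
  then show "E \<in> sets uniforms"
    unfolding E by (simp add: uniforms_def)
  have "emeasure (PiM UNIV ?M) {u \<in> space (PiM UNIV ?M). \<forall>k\<in>{0, 1}. u k \<in> ?X k} =
      (\<Prod>k\<in>{0, 1}. emeasure (?M k) (?X k))"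
    using X by (intro emeasure_PiM_Collect) auto
  also have "\<dots> = ennreal ((y - x) * (y' - x'))"
    using assms by (simp add: interval ennreal_mult)
  finally show "measure uniforms E = (y - x) * (y' - x')"
    using assms unfolding E by (simp add: uniforms_def measure_def)
qed

lemma partial_sum_bounds:
  fixes f :: "nat \<Rightarrow> real"
  assumes "\<And>l. l < m \<Longrightarrow> f l \<ge> 0" "(\<Sum>l<m. f l) = 1" "a < m"
  shows "0 \<le> (\<Sum>l<a. f l)" "(\<Sum>l<a. f l) \<le> (\<Sum>l<a + 1. f l)" "(\<Sum>l<a + 1. f l) \<le> 1"
proof -
  show "0 \<le> (\<Sum>l<a. f l)" using assms by (intro sum_nonneg) auto
  show "(\<Sum>l<a. f l) \<le> (\<Sum>l<a + 1. f l)" using assms by simp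
  have "(\<Sum>l<a + 1. f l) \<le> (\<Sum>l<m. f l)" using assms by (intro sum_mono2) auto
  with assms(2) show "(\<Sum>l<a + 1. f l) \<le> 1" by simp
qed

text \<open>
  For fixed \<open>a\<close> and \<open>j\<close>, the call returns them if and only if the first random number lies in an
  interval of length \<open>\<pi> i a\<close> and the second in one of length \<open>P a i j\<close>.
\<close>

lemma generates_transition_sample_prog:
  assumes mdp: "is_mdp n m P" and rep: "represents n m p q P \<pi> s" and "i < n" "m < 2 ^ p" "n < 2 ^ q"
  shows "generates_transition sample_prog n m P \<pi>\<^sub>0 \<pi> s i"
  unfolding generates_transition_def
proof (intro allI impI)
  fix a j
  assume aj: "a < m" "j < n"
  obtain c where c: "c i > 0" and
    forest: "forest n m p q (\<lambda>i a. if a < m then c i * \<pi> i a else 0)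
         (\<lambda>i a j. if j < n then P a i j else 0) (rmem s)"
    using rep \<open>i < n\<close> unfolding represents_def by blast
  have policy: "\<And>a. a < m \<Longrightarrow> \<pi> i a \<ge> 0" "(\<Sum>a<m. \<pi> i a) = 1"
    using rep \<open>i < n\<close> by (auto simp: represents_def is_policy_def)
  have kernel: "\<And>j. j < n \<Longrightarrow> P a i j \<ge> 0" "(\<Sum>j<n. P a i j) = 1"
    using mdp \<open>i < n\<close> aj by (auto simp: is_mdp_def)
  \<comment> \<open>Passing the arguments overwrites real cell 0, which lies outside all trees.\<close>
  let ?\<mu> = "(rmem s)(0 := 0)"
  have "forest n m p q (\<lambda>i a. if a < m then c i * \<pi> i a else 0)
         (\<lambda>i a j. if j < n then P a i j else 0) ?\<mu>"
    using forest by (subst forest_cong[where \<mu> = "rmem s"]) auto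
  then have trees: "sum_tree p (slot m p q i 0) (\<lambda>l. if l < m then c i * \<pi> i l else 0) ?\<mu>"
    "sum_tree q (slot m p q i (a + 1)) (\<lambda>l. if l < n then 1 * P a i l else 0) ?\<mu>"
    using \<open>i < n\<close> aj unfolding forest_def mult_1 by auto
  define E where "E = {u \<in> space uniforms. u 0 \<in> {(\<Sum>l<a. \<pi> i l)..<(\<Sum>l<a + 1. \<pi> i l)} \<and>
    u 1 \<in> {(\<Sum>l<j. P a i l)..<(\<Sum>l<j + 1. P a i l)}}"
  have "sample_event sample_prog P \<pi>\<^sub>0 s i a j = E"
    unfolding sample_event_def E_def
  proof (rule Collect_cong, rule conj_cong[OF refl])
    fix u :: "nat \<Rightarrow> real"
    assume "u \<in> space uniforms"
    then have u: "0 \<le> u k" for k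
      by (auto simp: uniforms_def space_PiM space_restrict_space PiE_iff)
    let ?s = "sample_call s i u"
    have s: "imem ?s 0 = i" "rmem ?s = ?\<mu>" "rnd ?s = u" "configured n m p q ?s"
      using rep by (auto simp: sample_call_def call_def represents_def configured_def)
    note R = runs_sample_prog[OF s(4,1), where P = P and \<pi> = \<pi>\<^sub>0, unfolded s(2,3)]
    have action: "drawn_action m p q ?\<mu> i (u 0) = a \<longleftrightarrow>
        u 0 \<in> {(\<Sum>l<a. \<pi> i l)..<(\<Sum>l<a + 1. \<pi> i l)}"
      unfolding drawn_action_def using trees c policy aj assms u by (intro descend_scaled_iff) auto
    have state: "drawn_state m p q ?\<mu> i a (u 1) = j \<longleftrightarrow>
        u 1 \<in> {(\<Sum>l<j. P a i l)..<(\<Sum>l<j + 1. P a i l)}"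
      unfolding drawn_state_def using trees kernel aj assms u
      by (intro descend_scaled_iff[where c = 1 and m = n]) auto
    have "(\<exists>t s'. exec P \<pi>\<^sub>0 sample_prog ?s t s' \<and> imem s' 0 = a \<and> imem s' 1 = j) \<longleftrightarrow>
        drawn_action m p q ?\<mu> i (u 0) = a \<and> drawn_state m p q ?\<mu> i a (u 1) = j"
      using R runs_exec[OF R] unfolding runs_def by metis
    then show "(\<exists>t s'. exec P \<pi>\<^sub>0 sample_prog ?s t s' \<and> imem s' 0 = a \<and> imem s' 1 = j) \<longleftrightarrow>
        u 0 \<in> {(\<Sum>l<a. \<pi> i l)..<(\<Sum>l<a + 1. \<pi> i l)} \<and>
        u 1 \<in> {(\<Sum>l<j. P a i l)..<(\<Sum>l<j + 1. P a i l)}"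
      unfolding action state .
  qed
  moreover have "E \<in> sets uniforms" "measure uniforms E = \<pi> i a * P a i j"
    using measure_uniforms_first_two[of "\<Sum>l<a. \<pi> i l" "\<Sum>l<a + 1. \<pi> i l"
        "\<Sum>l<j. P a i l" "\<Sum>l<j + 1. P a i l"]
      partial_sum_bounds[of m "\<pi> i" a] partial_sum_bounds[of n "P a i" j] policy kernel aj
    unfolding E_def by simp_all
  ultimately show "sample_event sample_prog P \<pi>\<^sub>0 s i a j \<in> sets uniforms \<and>
      measure uniforms (sample_event sample_prog P \<pi>\<^sub>0 s i a j) = \<pi> i a * P a i j"
    by simp
qed


section \<open>The time bounds\<close>

lemma ex_power2_between: "m \<ge> 1 \<Longrightarrow> \<exists>p. m < 2 ^ p \<and> 2 ^ p \<le> 2 * (m::nat)"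
proof (induction m rule: nat_induct_at_least)
  case base
  show ?case by (rule exI[of _ 1]) simp
next
  case (Suc m)
  then obtain p where p: "m < 2 ^ p" "2 ^ p \<le> 2 * m" by blast
  show ?case
  proof (cases "Suc m < 2 ^ p")
    case True
    with p show ?thesis by (intro exI[of _ p]) simp
  next
    case False
    with p have "Suc m = 2 ^ p" by simp
    then show ?thesis by (intro exI[of _ "Suc p"]) simp
  qed
qed

lemma exponent_le_log:
  assumes "2 ^ p \<le> 2 * (m::nat)" "m \<ge> 1"
  shows "real p \<le> 1 + log 2 (real m)"
proof -
  have "real (2 ^ p) \<le> real (2 * m)"
    using assms(1) by (simp only: of_nat_le_iff)
  then have "2 powr real p \<le> 2 * real m"
    by (simp add: powr_realpow)
  then have "real p \<le> log 2 (2 * real m)"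
    using assms by (simp add: le_log_iff)
  also have "\<dots> = 1 + log 2 (real m)"
    using assms by (simp add: log_mult)
  finally show ?thesis .
qed

text \<open>
  Each of the \<open>n * n * m\<close> entries of the transition probabilities costs a multiple of \<open>1 + q\<close>;
  loading the policy and setting up are dominated by this up to the factor \<open>1 + p\<close>.
\<close>

lemma preprocess_time:
  fixes n m p q :: nat
  assumes "n \<ge> 1" "m \<ge> 1"
  shows "n * (m * (26 * p + n * (26 * q + 100) + 200) + 40) + 20 * p + 20 * q + 100 \<le>
    600 * ((n * n * m) * (1 + p + q))"
proof -
  define L where "L = 1 + p + q"
  have "p \<le> L" "q \<le> L" "1 \<le> L"
    by (simp_all add: L_def)
  then have pq: "26 * p + 200 \<le> 226 * L" "26 * q + 100 \<le> 126 * L" "20 * p + 20 * q + 100 \<le> 140 * L" "1 \<le> L"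
    by linarith+
  have nm: "n * m \<le> n * n * m" "n \<le> n * n * m" "1 \<le> n * n * m"
    using assms by (auto simp: Suc_le_eq)
  have "n * (m * (26 * p + n * (26 * q + 100) + 200) + 40) =
      (n * m) * (26 * p + 200) + (n * n * m) * (26 * q + 100) + n * 40"
    by (simp add: algebra_simps)
  also have "\<dots> \<le> (n * n * m) * (226 * L) + (n * n * m) * (126 * L) + (n * n * m) * (40 * L)"
    using pq nm by (intro add_mono mult_mono) auto
  finally have "n * (m * (26 * p + n * (26 * q + 100) + 200) + 40) \<le> 392 * ((n * n * m) * L)"
    by (simp add: algebra_simps)
  moreover have "20 * p + 20 * q + 100 \<le> 140 * ((n * n * m) * L)"
    using pq(3) mult_mono[OF nm(3), of L L] by linarith
  ultimately show ?thesis
    unfolding L_def[symmetric] by linarith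
qed

theorem proposition1:
  shows "\<exists>(prep :: com) (upd :: com) (smp :: com) (C :: real) (k :: nat).
    \<forall>(n :: nat) (m :: nat) (P :: nat \<Rightarrow> nat \<Rightarrow> nat \<Rightarrow> real) (\<pi>\<^sub>0 :: nat \<Rightarrow> nat \<Rightarrow> real).
      n \<ge> 1 \<longrightarrow> m \<ge> 1 \<longrightarrow> is_mdp n m P \<longrightarrow> is_policy n m \<pi>\<^sub>0 \<longrightarrow>
      (\<forall>u\<in>space uniforms.
         halts_within P \<pi>\<^sub>0 prep (prep_call n m u)
           (C * (real n ^ 2 * real m) * (1 + log 2 (real n) + log 2 (real m)) ^ k)) \<and>
      (\<forall>\<pi> s. reachable prep upd smp n m P \<pi>\<^sub>0 \<pi> s \<longrightarrow>
         (\<forall>i a x. valid_update n m \<pi> i a x \<longrightarrow>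
            (\<forall>u\<in>space uniforms.
               halts_within P \<pi>\<^sub>0 upd (update_call s i a x u) (C * (1 + log 2 (real m))))) \<and>
         (\<forall>i<n.
            (\<forall>u\<in>space uniforms.
               halts_within P \<pi>\<^sub>0 smp (sample_call s i u)
                 (C * (1 + log 2 (real m)) + C * (1 + log 2 (real n)))) \<and>
            generates_transition smp n m P \<pi>\<^sub>0 \<pi> s i))"
proof (rule exI[of _ preprocess_prog], rule exI[of _ update_prog], rule exI[of _ sample_prog],
    rule exI[of _ 1800], rule exI[of _ 1], intro allI impI)
  fix n m :: nat and P :: "nat \<Rightarrow> nat \<Rightarrow> nat \<Rightarrow> real" and \<pi>\<^sub>0 :: "nat \<Rightarrow> nat \<Rightarrow> real"
  assume nm: "n \<ge> 1" "m \<ge> 1" and mdp: "is_mdp n m P" and policy: "is_policy n m \<pi>\<^sub>0"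
  obtain p where p: "m < 2 ^ p" "2 ^ p \<le> 2 * m"
    using ex_power2_between[OF nm(2)] by blast
  obtain q where q: "n < 2 ^ q" "2 ^ q \<le> 2 * n"
    using ex_power2_between[OF nm(1)] by blast
  note pq_log = exponent_le_log[OF p(2) nm(2)] exponent_le_log[OF q(2) nm(1)]
  have log: "log 2 (real n) \<ge> 0" "log 2 (real m) \<ge> 0"
    using nm by simp_all
  have prep: "halts_within P \<pi>\<^sub>0 preprocess_prog (prep_call n m u)
      (1800 * (real n ^ 2 * real m) * (1 + log 2 (real n) + log 2 (real m)) ^ 1)" for u
  proof (rule runs_halts_within[OF runs_preprocess_prog[OF p q]])
    have "real (n * (m * (26 * p + n * (26 * q + 100) + 200) + 40) + 20 * p + 20 * q + 100) \<le>
        real (600 * ((n * n * m) * (1 + p + q)))"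
      using preprocess_time[OF nm, of p q] by (rule of_nat_mono)
    also have "\<dots> = 600 * (real n ^ 2 * real m) * (1 + real p + real q)"
      by (simp add: power2_eq_square algebra_simps)
    \<comment> \<open>The exponents are at most \<open>1 + log 2 m\<close> and \<open>1 + log 2 n\<close>, which costs a factor of 3.\<close>
    also have "\<dots> \<le> 600 * (real n ^ 2 * real m) * (3 * (1 + log 2 (real n) + log 2 (real m)))"
      using pq_log log by (intro mult_left_mono) auto
    also have "\<dots> = 1800 * (real n ^ 2 * real m) * (1 + log 2 (real n) + log 2 (real m)) ^ 1"
      by (simp add: algebra_simps)
    finally show "real (n * (m * (26 * p + n * (26 * q + 100) + 200) + 40) + 20 * p + 20 * q + 100) \<le>
        1800 * (real n ^ 2 * real m) * (1 + log 2 (real n) + log 2 (real m)) ^ 1" .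
  qed
  have update: "halts_within P \<pi>\<^sub>0 update_prog (update_call s i a x u) (1800 * (1 + log 2 (real m)))"
    if "represents n m p q P \<pi> s" "valid_update n m \<pi> i a x" for \<pi> s i a x u
  proof (rule runs_halts_within[OF runs_update_prog])
    show "configured n m p q (update_call s i a x u)" "imem (update_call s i a x u) 0 = i"
      "imem (update_call s i a x u) 1 = a" "a < 2 ^ p"
      using that p by (auto simp: update_call_def call_def represents_def configured_def valid_update_def)
    show "real (26 * p + 100) \<le> 1800 * (1 + log 2 (real m))"
      using pq_log log by simp
  qed
  have sample: "halts_within P \<pi>\<^sub>0 sample_prog (sample_call s i u)
      (1800 * (1 + log 2 (real m)) + 1800 * (1 + log 2 (real n)))"
    if "represents n m p q P \<pi> s" for \<pi> s i u
  proof (rule runs_halts_within[OF runs_sample_prog])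
    show "configured n m p q (sample_call s i u)" "imem (sample_call s i u) 0 = i"
      using that by (auto simp: sample_call_def call_def represents_def configured_def)
    show "real (50 * p + 50 * q + 200) \<le> 1800 * (1 + log 2 (real m)) + 1800 * (1 + log 2 (real n))"
      using pq_log log by simp
  qed
  note rep = reachable_represents[OF _ policy p q]
  show "(\<forall>u\<in>space uniforms.
         halts_within P \<pi>\<^sub>0 preprocess_prog (prep_call n m u)
           (1800 * (real n ^ 2 * real m) * (1 + log 2 (real n) + log 2 (real m)) ^ 1)) \<and>
      (\<forall>\<pi> s. reachable preprocess_prog update_prog sample_prog n m P \<pi>\<^sub>0 \<pi> s \<longrightarrow>
         (\<forall>i a x. valid_update n m \<pi> i a x \<longrightarrow>
            (\<forall>u\<in>space uniforms.
               halts_within P \<pi>\<^sub>0 update_prog (update_call s i a x u) (1800 * (1 + log 2 (real m))))) \<and>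
         (\<forall>i<n.
            (\<forall>u\<in>space uniforms.
               halts_within P \<pi>\<^sub>0 sample_prog (sample_call s i u)
                 (1800 * (1 + log 2 (real m)) + 1800 * (1 + log 2 (real n)))) \<and>
            generates_transition sample_prog n m P \<pi>\<^sub>0 \<pi> s i))"
    by (intro conjI ballI allI impI prep update[OF rep] sample[OF rep]
        generates_transition_sample_prog[OF mdp rep _ p(1) q(1)])
qed

end
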